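(* For every integer $k\geq1$, $\lambda_c(k)>e-1$, where $\lambda_c(k)$ is the infimum of the set of $\lambda>0$ such that reconstruction is possible for $k$ and the matrix $$\mathbf{P}=\begin{pmatrix} p_{00} & p_{01} \\ p_{10} & p_{11} \end{pmatrix}=\begin{pmatrix} \frac{1}{1+w} & \frac{w}{1+w} \\ 1 & 0 \end{pmatrix},$$ with $w>0$ being the unique positive solution of $\lambda=w(1+w)^k$ (and with the convention $\inf\emptyset=+\infty$).
   Context: $\mathbb{T}^k$ denotes the infinite rooted tree in which every node has exactly $k$ children. For the stochastic matrix $\mathbf{P}$ in the claim, put $\pi_0=p_{10}/(p_{01}+p_{10})=(1+w)/(1+2w)$ and $\pi_1=1-\pi_0=w/(1+2w)$. Branching random walk: a random configuration $\phi=\{\phi(u),u\in\mathbb{T}^k\}\in\{0,1\}^{\mathbb{T}^k}$ is generated as follows. The root takes value $0$ with probability $\pi_0$ and value $1$ with probability $\pi_1$. Recursively, if a node has value $i$, each of its $k$ children takes value $0$ with probability $p_{i0}$ and value $1$ with probability $p_{i1}$, all choices being made independently. Let $\mu$ be the law of $\phi$ on $\{0,1\}^{\mathbb{T}^k}$. For a node $u$ and $d\geq1$, let $\mathbb{W}_d(u)$ be the set of descendants of $u$ at distance exactly $d$ from $u$. For $S\subseteq\mathbb{T}^k$, $\sigma(S)$ is the $\sigma$-algebra generated by $\{\phi(v),v\in S\}$. Let $$\mathcal{T}(u)=\bigcap_{d=1}^\infty\sigma\Big(\bigcup_{d'=d}^\infty\mathbb{W}_{d'}(u)\Big),\qquad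 A(u)=\mu(\phi(u)=0\mid\mathcal{T}(u)).$$ The distribution of $A(u)$ is the same for all $u\in\mathbb{T}^k$. For given $\mathbf{P}$ and $k$, reconstruction is said to be impossible if the random variable $A(u)$ is $\mu$-almost surely constant, and possible otherwise. *)

theory Defs
  imports "HOL-Probability.Probability"
begin

text \<open>Nodes of \<open>\<bbbT>\<^sup>k\<close> are addresses over \<open>{0, \<dots>, k - 1}\<close>, read from the node up to the root:
  the root is \<open>[]\<close> and the children of \<open>u\<close> are \<open>i # u\<close> for \<open>i < k\<close>.\<close>

definition nodes :: "nat \<Rightarrow> nat list set" where
  "nodes k = lists {..<k}"

definition descendants :: "nat \<Rightarrow> nat list \<Rightarrow> nat \<Rightarrow> nat list set" where
  "descendants k u d = {v @ u | v. v \<in> nodes k \<and> length v = d}"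

text \<open>The states \<open>0\<close> and \<open>1\<close> are represented by \<^term>\<open>False\<close> and \<^term>\<open>True\<close>; \<open>p i j\<close> is the
  probability of passing from \<open>i\<close> to \<open>j\<close>.\<close>

definition stochastic :: "(bool \<Rightarrow> bool \<Rightarrow> real) \<Rightarrow> bool" where
  "stochastic p \<longleftrightarrow> (\<forall>i j. 0 \<le> p i j) \<and> (\<forall>i. p i False + p i True = 1)"

definition stationary0 :: "(bool \<Rightarrow> bool \<Rightarrow> real) \<Rightarrow> real" where
  "stationary0 p = p True False / (p False True + p True False)"

definition root_law :: "(bool \<Rightarrow> bool \<Rightarrow> real) \<Rightarrow> bool pmf" where
  "root_law p = bernoulli_pmf (1 - stationary0 p)"

definition step_law :: "(bool \<Rightarrow> bool \<Rightarrow> real) \<Rightarrow> bool \<Rightarrow> bool pmf" where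
  "step_law p i = bernoulli_pmf (p i True)"

lemma pmf_step_law: "stochastic p \<Longrightarrow> pmf (step_law p i) j = p i j"
proof -
  assume "stochastic p"
  hence "0 \<le> p i False" "0 \<le> p i True" "p i False + p i True = 1"
    by (auto simp: stochastic_def)
  thus ?thesis by (cases j) (auto simp: step_law_def)
qed

definition config_space :: "nat \<Rightarrow> (nat list \<Rightarrow> bool) measure" where
  "config_space k = PiM (nodes k) (\<lambda>_. count_space UNIV)"

text \<open>The branching random walk is driven by independent choices: the root value \<open>a\<close>, and for every
  non-root node \<open>v\<close> and every state \<open>i\<close> the value \<open>c (v, i)\<close> which \<open>v\<close> takes if its parent
  has value \<open>i\<close>.\<close>

definition choices :: "nat \<Rightarrow> (bool \<Rightarrow> bool \<Rightarrow> real) \<Rightarrow> (bool \<times> (nat list \<times> bool \<Rightarrow> bool)) measure" where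
  "choices k p = measure_pmf (root_law p) \<Otimes>\<^sub>M
     PiM ((nodes k - {[]}) \<times> UNIV) (\<lambda>(v, i). measure_pmf (step_law p i))"

primrec node_value :: "bool \<Rightarrow> (nat list \<times> bool \<Rightarrow> bool) \<Rightarrow> nat list \<Rightarrow> bool" where
  "node_value a c [] = a"
| "node_value a c (i # u) = c (i # u, node_value a c u)"

definition brw :: "nat \<Rightarrow> (bool \<Rightarrow> bool \<Rightarrow> real) \<Rightarrow> (nat list \<Rightarrow> bool) measure" where
  "brw k p = distr (choices k p) (config_space k) (\<lambda>(a, c). \<lambda>u\<in>nodes k. node_value a c u)"

lemma space_config_space: "space (config_space k) = nodes k \<rightarrow>\<^sub>E UNIV"
  by (simp add: config_space_def space_PiM)

lemma measurable_node_value: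
  assumes "u \<in> nodes k"
  shows "(\<lambda>(a, c). node_value a c u) \<in> measurable (choices k p) (count_space UNIV)"
  using assms
proof (induction u)
  case Nil
  show ?case by (simp add: choices_def case_prod_beta)
next
  case (Cons i u)
  have u: "u \<in> nodes k" using Cons.prems by (auto simp: nodes_def)
  have c: "(\<lambda>x. snd x (i # u, b)) \<in> measurable (choices k p) (count_space UNIV)" for b
  proof -
    have "(\<lambda>c. c (i # u, b)) \<in> measurable
        (PiM ((nodes k - {[]}) \<times> UNIV) (\<lambda>(v, i). measure_pmf (step_law p i)))
        (case (i # u, b) of (v, i) \<Rightarrow> measure_pmf (step_law p i))"
      using Cons.prems by (intro measurable_component_singleton) auto
    thus ?thesis unfolding choices_def by simp
  qed
  have "(\<lambda>x. if node_value (fst x) (snd x) u then snd x (i # u, True) else snd x (i # u, False))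
      \<in> measurable (choices k p) (count_space UNIV)"
    using Cons.IH[OF u] c by (intro measurable_If) (auto simp: case_prod_beta pred_def)
  also have "(\<lambda>x. if node_value (fst x) (snd x) u then snd x (i # u, True) else snd x (i # u, False))
      = (\<lambda>(a, c). node_value a c (i # u))"
    by (auto simp: fun_eq_iff)
  finally show ?case .
qed

lemma measurable_brw:
  "(\<lambda>(a, c). \<lambda>u\<in>nodes k. node_value a c u) \<in> measurable (choices k p) (config_space k)"
  unfolding config_space_def case_prod_beta
  by (intro measurable_restrict measurable_node_value[unfolded case_prod_beta])

lemma prob_space_brw: "prob_space (brw k p)"
proof -
  have "prob_space (PiM ((nodes k - {[]}) \<times> (UNIV :: bool set))
      (\<lambda>(v :: nat list, i). measure_pmf (step_law p i)))"
    by (intro prob_space_PiM) (auto intro: measure_pmf.prob_space_axioms)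
  hence "prob_space (choices k p)"
    unfolding choices_def
    by (intro prob_space_pair) (auto intro: measure_pmf.prob_space_axioms)
  thus ?thesis
    unfolding brw_def by (rule prob_space.prob_space_distr) (rule measurable_brw)
qed

definition coord_algebra :: "nat \<Rightarrow> nat list set \<Rightarrow> (nat list \<Rightarrow> bool) set set" where
  "coord_algebra k S = sigma_sets (space (config_space k))
     {(\<lambda>\<phi>. \<phi> v) -` B \<inter> space (config_space k) | v B. v \<in> S}"

definition tail_algebra :: "nat \<Rightarrow> nat list \<Rightarrow> (nat list \<Rightarrow> bool) measure" where
  "tail_algebra k u = sigma (space (config_space k))
     (\<Inter>d\<in>{1..}. coord_algebra k (\<Union>d'\<in>{d..}. descendants k u d'))"

lemma coord_algebra_sigma_algebra:
  "sigma_algebra (space (config_space k)) (coord_algebra k S)"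
  unfolding coord_algebra_def by (rule sigma_algebra_sigma_sets) auto

lemma coord_algebra_subset:
  assumes "S \<subseteq> nodes k"
  shows "coord_algebra k S \<subseteq> sets (config_space k)"
  unfolding coord_algebra_def
proof (rule sets.sigma_sets_subset, safe)
  fix v B assume "v \<in> S"
  hence "v \<in> nodes k" using assms by auto
  thus "(\<lambda>\<phi>. \<phi> v) -` B \<inter> space (config_space k) \<in> sets (config_space k)"
    unfolding config_space_def by (intro measurable_sets[OF measurable_component_singleton]) auto
qed

lemma sets_tail_algebra:
  "sets (tail_algebra k u) =
     (\<Inter>d\<in>{1..}. coord_algebra k (\<Union>d'\<in>{d..}. descendants k u d'))" (is "_ = ?T")
proof -
  let ?C = "\<lambda>d. coord_algebra k (\<Union>d'\<in>{d..}. descendants k u d')"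
  have Pow: "?T \<subseteq> Pow (space (config_space k))"
  proof -
    have "?T \<subseteq> ?C 1" by (rule INT_lower) simp
    also have "?C 1 \<subseteq> Pow (space (config_space k))"
      by (rule subset_class.space_closed)
        (use coord_algebra_sigma_algebra in \<open>simp add: sigma_algebra_iff2 subset_class_def\<close>)
    finally show ?thesis .
  qed
  have "sigma_sets (space (config_space k)) ?T \<subseteq> ?T"
  proof (rule INT_greatest)
    fix d :: nat assume "d \<in> {1..}"
    hence "?T \<subseteq> ?C d" by (rule INT_lower)
    thus "sigma_sets (space (config_space k)) ?T \<subseteq> ?C d"
      by (rule sigma_algebra.sigma_sets_subset[OF coord_algebra_sigma_algebra])
  qed
  moreover have "?T \<subseteq> sigma_sets (space (config_space k)) ?T"
    by (rule sigma_sets_superset_generator)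
  moreover have "sets (tail_algebra k u) = sigma_sets (space (config_space k)) ?T"
    unfolding tail_algebra_def by (rule sets_measure_of[OF Pow])
  ultimately show ?thesis by simp
qed

lemma subalgebra_tail_algebra:
  assumes "u \<in> nodes k"
  shows "subalgebra (brw k p) (tail_algebra k u)"
proof -
  have "(\<Union>d'\<in>{1..}. descendants k u d') \<subseteq> nodes k"
    using assms by (auto simp: descendants_def nodes_def)
  hence "coord_algebra k (\<Union>d'\<in>{1..}. descendants k u d') \<subseteq> sets (config_space k)"
    by (rule coord_algebra_subset)
  hence "sets (tail_algebra k u) \<subseteq> sets (config_space k)"
    unfolding sets_tail_algebra by blast
  thus ?thesis
    by (simp add: subalgebra_def brw_def tail_algebra_def space_measure_of_conv)
qed

definition posterior0 ::
  "nat \<Rightarrow> (bool \<Rightarrow> bool \<Rightarrow> real) \<Rightarrow> nat list \<Rightarrow> (nat list \<Rightarrow> bool) \<Rightarrow> real" where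
  "posterior0 k p u = real_cond_exp (brw k p) (tail_algebra k u)
     (indicator {\<phi> \<in> space (brw k p). \<phi> u = False})"

definition reconstruction_impossible :: "nat \<Rightarrow> (bool \<Rightarrow> bool \<Rightarrow> real) \<Rightarrow> bool" where
  "reconstruction_impossible k p \<longleftrightarrow>
     (\<forall>u\<in>nodes k. \<exists>c. AE \<phi> in brw k p. posterior0 k p u \<phi> = c)"

definition reconstruction_possible :: "nat \<Rightarrow> (bool \<Rightarrow> bool \<Rightarrow> real) \<Rightarrow> bool" where
  "reconstruction_possible k p \<longleftrightarrow> \<not> reconstruction_impossible k p"

definition hardcore_matrix :: "real \<Rightarrow> bool \<Rightarrow> bool \<Rightarrow> real" where
  "hardcore_matrix w i j =
     (if i then (if j then 0 else 1) else (if j then w / (1 + w) else 1 / (1 + w)))"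

lemma stochastic_hardcore_matrix: "w > 0 \<Longrightarrow> stochastic (hardcore_matrix w)"
  by (auto simp: stochastic_def hardcore_matrix_def add_divide_distrib[symmetric])

lemma stationary0_hardcore_matrix:
  "w > 0 \<Longrightarrow> stationary0 (hardcore_matrix w) = (1 + w) / (1 + 2 * w)"
  by (simp add: stationary0_def hardcore_matrix_def field_simps)

definition fugacity_root :: "nat \<Rightarrow> real \<Rightarrow> real" where
  "fugacity_root k lam = (THE w. w > 0 \<and> lam = w * (1 + w) ^ k)"

lemma fugacity_root_ex1:
  fixes lam :: real
  assumes "lam > 0"
  shows "\<exists>!w. w > 0 \<and> lam = w * (1 + w) ^ k"
proof -
  let ?f = "\<lambda>w::real. w * (1 + w) ^ k"
  have "lam * 1 \<le> ?f lam"
    using assms by (intro mult_left_mono one_le_power) auto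
  hence "\<exists>w. 0 \<le> w \<and> w \<le> lam \<and> ?f w = lam"
    using assms by (intro IVT') (auto intro!: continuous_intros)
  then obtain w where w: "0 \<le> w" "?f w = lam" by auto
  have mono: "?f x < ?f y" if "0 < x" "x < y" for x y
  proof -
    have "?f x \<le> x * (1 + y) ^ k"
      using that by (intro mult_left_mono power_mono) simp_all
    also have "\<dots> < ?f y"
      using that by (intro mult_strict_right_mono zero_less_power) simp_all
    finally show ?thesis .
  qed
  have "w > 0" using w assms by (cases "w = 0") simp_all
  show ?thesis
  proof (rule ex1I[of _ w])
    show "w > 0 \<and> lam = ?f w" using \<open>w > 0\<close> w by simp
  next
    fix v assume v: "v > 0 \<and> lam = ?f v"
    show "v = w"
      using mono[of v w] mono[of w v] v w \<open>w > 0\<close> by (metis less_irrefl linorder_neqE)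
  qed
qed

text \<open>The infimum is taken in \<^typ>\<open>ereal\<close>, where the infimum of the empty set is \<open>\<infinity>\<close>.\<close>

definition lambda_c :: "nat \<Rightarrow> ereal" where
  "lambda_c k = Inf {ereal lam | lam. lam > 0 \<and>
     reconstruction_possible k (hardcore_matrix (fugacity_root k lam))}"

end

theory Submission imports Defs
begin

text \<open>
  Forcing the value at a node \<open>u\<close> to be \<open>0\<close> or \<open>1\<close> gives two laws of the tree below \<open>u\<close>. If
  they agree on all tail events, then the tail at \<open>u\<close> is independent of the value at \<open>u\<close>, and
  the posterior probability is constant. So let \<open>R\<close> be the likelihood ratio of the law forced to
  \<open>1\<close> against the law forced to \<open>0\<close> on the levels beyond some distance; the aim is that \<open>R\<close>
  tends to \<open>1\<close> with growing distance. The subtrees of the children are independent given the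
  value at \<open>u\<close>, so \<open>R\<close> is the product of \<open>(1 + w) / (1 + w R\<^sub>j)\<close> over the children \<open>j\<close>
  (\<open>distr_True_eq_density\<close>, \<open>zero_density_law\<close>). In particular \<open>R \<le> (1 + w)\<^sup>k\<close>.

  The idea is to follow the divergence \<open>E\<^sub>0 ((R - 1) ln R)\<close>,
  where \<open>E\<^sub>0\<close> is the expectation under the law forced to \<open>0\<close>. It equals
  \<open>E\<^sub>1 (ln R) - E\<^sub>0 (ln R)\<close>, and the logarithm turns the product over the children into a sum. A
  node of value \<open>1\<close> has only children of value \<open>0\<close>, a node of value \<open>0\<close> has children of value
  \<open>1\<close> with probability \<open>w / (1 + w)\<close>; so the divergence at \<open>u\<close> is
  \<open>w / (1 + w)\<close> times the sum over the children of \<open>E\<^sub>0 ((R\<^sub>j - 1) ln ((1 + w R\<^sub>j) / (1 + w)))\<close>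
  (\<open>divergence_Suc\<close>). As \<open>ln (1 + w exp t)\<close> is convex in \<open>t\<close> and \<open>R\<^sub>j \<le> (1 + w)\<^sup>k\<close>, this
  integrand is at most a constant times \<open>(R\<^sub>j - 1) ln R\<^sub>j\<close>, the constant being the slope of the
  secant at the largest value of \<open>R\<^sub>j\<close> (\<open>secant_bound\<close>). Altogether the divergence shrinks at
  each level by a factor that is less than \<open>1\<close> when
  \<open>w ln (1 + \<lambda>) < (1 + 2 w) ln (1 + w)\<close>, where \<open>\<lambda> = w (1 + w)\<^sup>k\<close> (\<open>divergence_contraction\<close>,
  \<open>contraction_less_1\<close>). Then it tends to \<open>0\<close>, and since it dominates the second moment of
  \<open>R - 1\<close> up to a constant, the two laws agree on the tail (\<open>tail_law_eq\<close>).

  Because \<open>ln (1 + w) \<ge> w / (1 + w)\<close>, the condition on \<open>w\<close> follows from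
  \<open>ln (1 + \<lambda>) < 1 + w / (1 + w)\<close>. For \<open>\<lambda> \<le> e - 1\<close> the left-hand side is at most \<open>1\<close>. For larger
  \<open>\<lambda>\<close> the root \<open>w\<close> is at least its value \<open>w\<^sub>0\<close> at \<open>e - 1\<close>, so the condition persists as long as
  \<open>ln (1 + \<lambda>) < 1 + w\<^sub>0 / (1 + w\<^sub>0)\<close>; the gain of \<open>w\<^sub>0 / (1 + w\<^sub>0) > 0\<close> makes the inequality
  strict.
\<close>

section \<open>Events below a node\<close>

definition subtree :: "nat \<Rightarrow> nat list \<Rightarrow> nat \<Rightarrow> nat list set" where
  "subtree k u d = (\<Union>d'\<in>{d..}. descendants k u d')"

lemma subtree_iff: "x \<in> subtree k u d \<longleftrightarrow> (\<exists>v. x = v @ u \<and> v \<in> nodes k \<and> d \<le> length v)"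
  by (auto simp: subtree_def descendants_def)

lemma Cons_in_nodes_iff [simp]: "j # u \<in> nodes k \<longleftrightarrow> j < k \<and> u \<in> nodes k"
  by (auto simp: nodes_def)

lemma append_in_nodes_iff [simp]: "v @ u \<in> nodes k \<longleftrightarrow> v \<in> nodes k \<and> u \<in> nodes k"
  by (auto simp: nodes_def)

lemma Nil_in_nodes [simp]: "[] \<in> nodes k"
  by (simp add: nodes_def)

lemma subtree_subset_nodes: "u \<in> nodes k \<Longrightarrow> subtree k u d \<subseteq> nodes k"
  by (auto simp: subtree_iff)

lemma subtree_antimono: "d \<le> d' \<Longrightarrow> subtree k u d' \<subseteq> subtree k u d"
  by (auto simp: subtree_iff)

lemma self_in_subtree: "u \<in> subtree k u 0"
  by (auto simp: subtree_iff)

lemma subtree_Suc: "subtree k u (Suc d) = (\<Union>j<k. subtree k (j # u) d)"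
proof (intro equalityI subsetI)
  fix x assume "x \<in> subtree k u (Suc d)"
  then obtain v where v: "x = v @ u" "v \<in> nodes k" "Suc d \<le> length v"
    by (auto simp: subtree_iff)
  then have "v \<noteq> []" by auto
  then obtain v' j where "v = v' @ [j]" by (metis rev_exhaust)
  with v show "x \<in> (\<Union>j<k. subtree k (j # u) d)"
    by (force simp: subtree_iff)
next
  fix x assume "x \<in> (\<Union>j<k. subtree k (j # u) d)"
  then obtain j v where "j < k" "x = v @ (j # u)" "v \<in> nodes k" "d \<le> length v"
    by (auto simp: subtree_iff)
  then have "x = (v @ [j]) @ u" "v @ [j] \<in> nodes k" "Suc d \<le> length (v @ [j])" by auto
  then show "x \<in> subtree k u (Suc d)" unfolding subtree_iff by blast
qed

lemma disjoint_subtrees: "disjoint_family_on (\<lambda>j. subtree k (j # u) d) J"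
  by (auto simp: disjoint_family_on_def subtree_iff append_eq_append_conv2 Cons_eq_append_conv)

text \<open>The \<open>\<sigma>\<close>-algebra generated by the values on \<open>S\<close>, as a measurable space, so
  that \<open>borel_measurable (coords k S)\<close> speaks of observables of \<open>S\<close>.\<close>

definition coords :: "nat \<Rightarrow> nat list set \<Rightarrow> (nat list \<Rightarrow> bool) measure" where
  "coords k S = sigma (space (config_space k))
     {(\<lambda>\<phi>. \<phi> v) -` B \<inter> space (config_space k) | v B. v \<in> S}"

lemma sets_coords: "sets (coords k S) = coord_algebra k S"
  unfolding coords_def coord_algebra_def by (rule sets_measure_of) auto

lemma space_coords [simp]: "space (coords k S) = space (config_space k)"
  unfolding coords_def by (rule space_measure_of) auto

lemma measurable_coords_mono:
  assumes "S \<subseteq> S'" "f \<in> measurable (coords k S) M"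
  shows "f \<in> measurable (coords k S') M"
proof (rule measurable_from_subalg[OF _ assms(2)], unfold subalgebra_def, intro conjI)
  show "sets (coords k S) \<subseteq> sets (coords k S')"
    unfolding sets_coords coord_algebra_def
    by (intro sigma_sets_subseteq Collect_mono impI)
      (elim exE conjE, intro exI conjI, assumption, erule subsetD[OF assms(1)])
qed simp

lemma measurable_coord:
  assumes "v \<in> S"
  shows "(\<lambda>\<phi>. \<phi> v) \<in> measurable (coords k S) (count_space UNIV)"
proof (rule measurableI)
  fix B :: "bool set"
  show "(\<lambda>\<phi>. \<phi> v) -` B \<inter> space (coords k S) \<in> sets (coords k S)"
    using assms unfolding sets_coords coord_algebra_def space_coords
    by (intro sigma_sets.Basic) auto
qed simp

text \<open>The event \<open>A\<close> is still a set of configurations of the whole tree; this is the sense in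
  which it only looks at \<open>S\<close>. It allows one configuration to be exchanged for another whose
  values off \<open>S\<close> are more convenient.\<close>

lemma coords_cong_set:
  assumes "A \<in> sets (coords k S)" "\<phi> \<in> space (config_space k)" "\<psi> \<in> space (config_space k)"
    and "\<And>v. v \<in> S \<Longrightarrow> \<phi> v = \<psi> v"
  shows "\<phi> \<in> A \<longleftrightarrow> \<psi> \<in> A"
  using assms(1) unfolding sets_coords coord_algebra_def
  by induction (use assms(2-4) in auto)

lemma coords_cong:
  fixes f :: "_ \<Rightarrow> 'b::t1_space"
  assumes "f \<in> borel_measurable (coords k S)"
    and "\<phi> \<in> space (config_space k)" "\<psi> \<in> space (config_space k)"
    and "\<And>v. v \<in> S \<Longrightarrow> \<phi> v = \<psi> v"
  shows "f \<phi> = f \<psi>"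
proof -
  have "f -` {f \<phi>} \<inter> space (coords k S) \<in> sets (coords k S)"
    using assms(1) by (rule measurable_sets) simp
  from coords_cong_set[OF this assms(2-4)] show ?thesis using assms(2,3) by auto
qed

section \<open>Forcing the value at a node\<close>

text \<open>An intervention on the branching random walk: the value at \<open>u\<close> is set to \<open>i\<close>, and the
  descendants of \<open>u\<close> then obey the same choices \<open>c\<close> as before. Outside
  the subtree of \<open>u\<close> the recursion starts from \<open>False\<close> at the root, as a default. Unlike
  conditioning on the value of \<open>u\<close>, forcing keeps both laws on one probability space and involves
  no division.\<close>

primrec forced_value :: "nat list \<Rightarrow> bool \<Rightarrow> (nat list \<times> bool \<Rightarrow> bool) \<Rightarrow> nat list \<Rightarrow> bool" where
  "forced_value u i c [] \<longleftrightarrow> u = [] \<and> i"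
| "forced_value u i c (j # x) = (if j # x = u then i else c (j # x, forced_value u i c x))"

lemma forced_value_self [simp]: "forced_value u i c u = i"
  by (cases u) auto

lemma node_value_eq_forced_value: "node_value a c (v @ u) = forced_value u (node_value a c u) c (v @ u)"
  by (induction v) auto

text \<open>The children of a forced node are themselves forced, each to the value that its own choice
  dictates. This identity carries the branching property.\<close>

lemma forced_value_child: "forced_value u i c (v @ j # u) =
    forced_value (j # u) (c (j # u, i)) c (v @ j # u)"
  by (induction v) auto

section \<open>Independence of the driving choices\<close>

locale broadcast =
  fixes k :: nat and p :: "bool \<Rightarrow> bool \<Rightarrow> real"
  assumes stochastic: "stochastic p"
begin

abbreviation noise_index :: "(nat list \<times> bool) set" where
  "noise_index \<equiv> (nodes k - {[]}) \<times> UNIV"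

text \<open>The second factor of \<open>choices k p\<close>: everything that drives the walk except the root value.\<close>

definition noise :: "(nat list \<times> bool \<Rightarrow> bool) measure" where
  "noise = PiM noise_index (\<lambda>(v, i). measure_pmf (step_law p i))"

sublocale noise_factors: product_prob_space "\<lambda>(v :: nat list, i). measure_pmf (step_law p i)"
    noise_index
  by (intro product_prob_spaceI) (auto intro: measure_pmf.prob_space_axioms)

sublocale noise: prob_space noise
  unfolding noise_def by (rule noise_factors.prob_space_axioms)

definition noise_of :: "(nat list \<times> bool) set \<Rightarrow> (nat list \<times> bool \<Rightarrow> bool) measure" where
  "noise_of K = sigma (space noise) (\<Union>x\<in>K. {(\<lambda>c. c x) -` B \<inter> space noise | B. True})"

lemma sets_noise_of: "sets (noise_of K) = sigma_sets (space noise) (\<Union>x\<in>K. {(\<lambda>c. c x) -` B \<inter>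
    space noise | B. True})"
  unfolding noise_of_def by (rule sets_measure_of) auto

lemma space_noise_of [simp]: "space (noise_of K) = space noise"
  unfolding noise_of_def by (rule space_measure_of) auto

lemma measurable_choice:
  assumes "x \<in> K"
  shows "(\<lambda>c. c x) \<in> measurable (noise_of K) (count_space UNIV)"
proof (rule measurableI)
  fix B :: "bool set"
  show "(\<lambda>c. c x) -` B \<inter> space (noise_of K) \<in> sets (noise_of K)"
    using assms unfolding sets_noise_of space_noise_of
    by (intro sigma_sets.Basic) auto
qed simp

lemma choice_event:
  assumes "x \<in> noise_index"
  shows "(\<lambda>c. c x) -` B \<inter> space noise \<in> sets noise"
proof -
  have "(\<lambda>c. c x) \<in> measurable noise (case x of (v, i) \<Rightarrow> measure_pmf (step_law p i))"
    unfolding noise_def using assms by (rule measurable_component_singleton)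
  then show ?thesis by (rule measurable_sets) (auto split: prod.split)
qed

lemma sets_noise_of_subset:
  assumes "K \<subseteq> noise_index"
  shows "sets (noise_of K) \<subseteq> sets noise"
  unfolding sets_noise_of
proof (intro sets.sigma_sets_subset UN_least)
  fix x assume "x \<in> K"
  then have "x \<in> noise_index" using assms by (rule subsetD[rotated])
  then show "{(\<lambda>c. c x) -` B \<inter> space noise |B. True} \<subseteq> sets noise"
    using choice_event[of x] by auto
qed

lemma measurable_noise_of_mono:
  assumes "K \<subseteq> K'" "f \<in> measurable (noise_of K) M"
  shows "f \<in> measurable (noise_of K') M"
proof (rule measurable_from_subalg[OF _ assms(2)], unfold subalgebra_def, intro conjI)
  show "sets (noise_of K) \<subseteq> sets (noise_of K')"
    unfolding sets_noise_of by (intro sigma_sets_subseteq UN_mono assms(1) order.refl)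
qed simp

lemma measurable_noise_if_noise_of:
  assumes "K \<subseteq> noise_index" "f \<in> measurable (noise_of K) M"
  shows "f \<in> measurable noise M"
  by (rule measurable_from_subalg[OF _ assms(2)])
    (use sets_noise_of_subset[OF assms(1)] in \<open>simp add: subalgebra_def\<close>)

text \<open>The one source of independence: the coordinates of a product measure are independent.\<close>

lemma indep_choices:
  "noise.indep_sets (\<lambda>x. {(\<lambda>c. c x) -` B \<inter> space noise | B. True}) noise_index"
proof (rule noise.indep_setsI)
  fix x assume "x \<in> noise_index"
  then show "{(\<lambda>c. c x) -` B \<inter> space noise |B. True} \<subseteq> noise.events" using choice_event by auto
next
  fix A J assume J: "J \<noteq> {}" "J \<subseteq> noise_index" "finite J"
    and A: "\<forall>j\<in>J. A j \<in> {(\<lambda>c. c j) -` B \<inter> space noise |B. True}"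
  then have "\<forall>j\<in>J. \<exists>B. A j = (\<lambda>c. c j) -` B \<inter> space noise" by simp
  from bchoice[OF this] obtain B where B: "\<And>j. j \<in> J \<Longrightarrow> A j = (\<lambda>c. c j) -` B j \<inter> space noise"
    by metis
  let ?M = "\<lambda>(v :: nat list, i). measure_pmf (step_law p i)"
  have sets: "B j \<in> sets (?M j)" for j by (cases j) auto
  have one: "noise.prob (A j) = measure (?M j) (B j)" if "j \<in> J" for j
  proof -
    have "A j = {c \<in> space noise. c j \<in> B j}" using B[OF that] by auto
    then have "emeasure noise (A j) = emeasure (?M j) (B j)"
      unfolding noise_def using noise_factors.emeasure_PiM_Collect_single[of j "B j"] sets that J by
          auto
    then show ?thesis by (simp add: measure_def)
  qed
  have "(\<Inter>j\<in>J. A j) = {c \<in> space noise. \<forall>j\<in>J. c j \<in> B j}" using B J(1) by auto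
  then have "emeasure noise (\<Inter>j\<in>J. A j) = (\<Prod>j\<in>J. emeasure (?M j) (B j))"
    unfolding noise_def using noise_factors.emeasure_PiM_Collect[of J B] sets J by auto
  also have "\<dots> = (\<Prod>j\<in>J. ennreal (measure (?M j) (B j)))"
    by (intro prod.cong) (auto simp: measure_pmf.emeasure_eq_measure)
  also have "\<dots> = ennreal (\<Prod>j\<in>J. measure (?M j) (B j))"
    by (rule prod_ennreal) simp
  also have "\<dots> = ennreal (\<Prod>j\<in>J. noise.prob (A j))" using one by simp
  finally show "noise.prob (\<Inter>j\<in>J. A j) = (\<Prod>j\<in>J. noise.prob (A j))"
    by (simp add: measure_def prod_nonneg enn2real_ennreal)
qed

text \<open>Disjoint blocks of choices generate independent \<open>\<sigma>\<close>-algebras, so that expectations of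
  products factor. All later uses of independence are instances: the blocks are the subtrees of
  the children of a node, or else some choices outside a subtree and those inside it.\<close>

lemma nn_integral_prod_disjoint:
  fixes f :: "'j \<Rightarrow> _ \<Rightarrow> ennreal"
  assumes "finite J" "disjoint_family_on K J" "\<And>j. j \<in> J \<Longrightarrow> K j \<subseteq> noise_index"
    and f: "\<And>j. j \<in> J \<Longrightarrow> f j \<in> borel_measurable (noise_of (K j))"
  shows "(\<integral>\<^sup>+c. (\<Prod>j\<in>J. f j c) \<partial>noise) = (\<Prod>j\<in>J. \<integral>\<^sup>+c. f j c \<partial>noise)"
proof (rule noise.indep_vars_nn_integral)
  have "noise.indep_sets (\<lambda>j. sets (noise_of (K j))) J"
    unfolding sets_noise_of
  proof (rule noise.indep_sets_collect_sigma)
    show "noise.indep_sets (\<lambda>x. {(\<lambda>c. c x) -` B \<inter> space noise | B. True}) (\<Union>j\<in>J. K j)"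
      by (rule noise.indep_sets_mono_index[OF _ indep_choices]) (use assms(3) in blast)
    show "Int_stable {(\<lambda>c. c x) -` B \<inter> space noise | B. True}" for x
    proof (rule Int_stableI, safe)
      fix B B' show "\<exists>B''. (\<lambda>c. c x) -` B \<inter> space noise \<inter> ((\<lambda>c. c x) -` B' \<inter> space noise) =
          (\<lambda>c. c x) -` B'' \<inter> space noise \<and> True"
        by (rule exI[of _ "B \<inter> B'"]) auto
    qed
  qed fact
  then have "noise.indep_sets (\<lambda>j. {f j -` A \<inter> space noise |A. A \<in> sets borel}) J"
    by (rule noise.indep_sets_mono_sets) (use measurable_sets[OF f] in auto)
  then show "noise.indep_vars (\<lambda>_. borel) f J"
    unfolding noise.indep_vars_def2
    using measurable_noise_if_noise_of[OF assms(3) f] by auto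
qed (use assms in auto)

definition config :: "nat list \<Rightarrow> bool \<Rightarrow> (nat list \<times> bool \<Rightarrow> bool) \<Rightarrow> nat list \<Rightarrow> bool" where
  "config u i c = (\<lambda>x\<in>nodes k. forced_value u i c x)"

lemma config_in_space [simp]: "config u i c \<in> space (config_space k)"
  by (auto simp: config_def space_config_space)

lemma config_self [simp]: "u \<in> nodes k \<Longrightarrow> config u i c u = i"
  by (simp add: config_def)

lemma subtree_choices_subset: "u \<in> nodes k \<Longrightarrow> subtree k u (Suc 0) \<times> UNIV \<subseteq> noise_index"
  by (auto simp: subtree_iff)

lemma measurable_forced_value:
  assumes "v \<in> nodes k" "u \<in> nodes k"
  shows "(\<lambda>c. forced_value u i c (v @ u)) \<in> measurable (noise_of (subtree k u (Suc 0) \<times> UNIV))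
      (count_space UNIV)"
  using assms
proof (induction v)
  case Nil
  then show ?case by simp
next
  case (Cons j v)
  then have "j # v @ u \<in> subtree k u (Suc 0)" by (auto simp: subtree_iff intro!: exI[of _ "j # v"])
  then have c: "(\<lambda>c. c (j # v @ u, b)) \<in> measurable (noise_of (subtree k u (Suc 0) \<times> UNIV))
      (count_space UNIV)" for b
    by (intro measurable_choice) auto
  have "j # v @ u \<noteq> u"
    by (metis append_Cons append_self_conv2 list.discI)
  then have "(\<lambda>c. forced_value u i c ((j # v) @ u)) =
      (\<lambda>c. if forced_value u i c (v @ u) then c (j # v @ u, True) else c (j # v @ u, False))"
    by (intro ext) (simp split: if_splits)
  also have "\<dots> \<in> measurable (noise_of (subtree k u (Suc 0) \<times> UNIV)) (count_space UNIV)"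
    using Cons c by (intro measurable_If) (auto simp: pred_def)
  finally show ?case .
qed

text \<open>Only the choices at the strict descendants of \<open>u\<close> enter, since the value at \<open>u\<close> is
  prescribed; hence the level \<open>Suc 0\<close> on the side of the choices.\<close>

lemma measurable_config:
  assumes "u \<in> nodes k"
  shows "config u i \<in> measurable (noise_of (subtree k u (Suc 0) \<times> UNIV)) (coords k (subtree k u d))"
  unfolding coords_def
proof (rule measurable_measure_of)
  fix A assume "A \<in> {(\<lambda>\<phi>. \<phi> v) -` B \<inter> space (config_space k) | v B. v \<in> subtree k u d}"
  then obtain x B where x: "x \<in> subtree k u d"
    and A': "A = (\<lambda>\<phi>. \<phi> x) -` B \<inter> space (config_space k)"
    by (simp only: mem_Collect_eq) (elim exE conjE)
  from x obtain v where v: "v \<in> nodes k" and xv: "x = v @ u"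
    unfolding subtree_iff by blast
  have A: "A = (\<lambda>\<phi>. \<phi> (v @ u)) -` B \<inter> space (config_space k)"
    using A' xv by simp
  have "config u i c \<in> A \<longleftrightarrow> forced_value u i c (v @ u) \<in> B" for c
    using v assms by (simp add: A) (simp add: config_def)
  then have "config u i -` A \<inter> space (noise_of (subtree k u (Suc 0) \<times> UNIV)) =
      (\<lambda>c. forced_value u i c (v @ u)) -` B \<inter> space (noise_of (subtree k u (Suc 0) \<times> UNIV))"
    by (simp add: vimage_def)
  also have "\<dots> \<in> sets (noise_of (subtree k u (Suc 0) \<times> UNIV))"
    by (rule measurable_sets[OF measurable_forced_value]) (use v assms in auto)
  finally show "config u i -` A \<inter> space (noise_of (subtree k u (Suc 0) \<times> UNIV))
    \<in> sets (noise_of (subtree k u (Suc 0) \<times> UNIV))" .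
qed auto

lemma measurable_config_noise:
  assumes "u \<in> nodes k"
  shows "config u i \<in> measurable noise (coords k (subtree k u d))"
  by (rule measurable_noise_if_noise_of[OF subtree_choices_subset[OF assms] measurable_config[OF
      assms]])

section \<open>The branching property\<close>

lemma config_child:
  assumes "u \<in> nodes k" "j < k" "x \<in> subtree k (j # u) 0"
  shows "config u i c x = config (j # u) (c (j # u, i)) c x"
  using assms forced_value_child by (auto simp: subtree_iff config_def)

lemma nn_integral_choice:
  assumes "u \<in> nodes k" "j < k"
  shows "(\<integral>\<^sup>+c. indicator {b} (c (j # u, i)) \<partial>noise) = ennreal (p i b)"
proof -
  have "(\<integral>\<^sup>+c. indicator {b} (c (j # u, i)) \<partial>noise) =
    (\<integral>\<^sup>+c. indicator {c \<in> space noise. c (j # u, i) \<in> {b}} c \<partial>noise)"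
    by (intro nn_integral_cong) (auto simp: indicator_def)
  also have "\<dots> = emeasure noise {c \<in> space noise. c (j # u, i) \<in> {b}}"
    using choice_event[of "(j # u, i)" "{b}"] assms
    by (intro nn_integral_indicator) (auto simp: vimage_def Int_def conj_commute)
  also have "\<dots> = ennreal (pmf (step_law p i) b)"
    unfolding noise_def using noise_factors.emeasure_PiM_Collect_single[of "(j # u, i)" "{b}"] assms
    by (simp add: emeasure_pmf_single)
  finally show ?thesis by (simp add: pmf_step_law[OF stochastic])
qed

lemma nn_integral_branching_single:
  fixes f :: "_ \<Rightarrow> ennreal"
  assumes u: "u \<in> nodes k" and j: "j < k"
    and f: "f \<in> borel_measurable (coords k (subtree k (j # u) 0))"
  shows "(\<integral>\<^sup>+c. f (config u i c) \<partial>noise) =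
    p i False * (\<integral>\<^sup>+c. f (config (j # u) False c) \<partial>noise) +
    p i True * (\<integral>\<^sup>+c. f (config (j # u) True c) \<partial>noise)"
proof -
  let ?g = "\<lambda>b c. f (config (j # u) b c)"
  have ju: "j # u \<in> nodes k" using u j by simp
  have meas: "?g b \<in> borel_measurable (noise_of (subtree k (j # u) (Suc 0) \<times> UNIV))" for b
    using measurable_compose[OF measurable_config[OF ju] f] .
  have [measurable]: "?g b \<in> borel_measurable noise" for b
    by (rule measurable_noise_if_noise_of[OF subtree_choices_subset[OF ju] meas])
  have ind: "(\<lambda>c. indicator {b} (c (j # u, i)) :: ennreal) \<in> borel_measurable (noise_of {(j # u,
      i)})" for b
    by (rule measurable_compose[OF measurable_choice]) auto
  have [measurable]: "(\<lambda>c. indicator {b} (c (j # u, i)) :: ennreal) \<in> borel_measurable noise" for b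
    by (rule measurable_noise_if_noise_of[OF _ ind]) (use ju in auto)
  have eq: "f (config u i c) = indicator {False} (c (j # u, i)) * ?g False c +
      indicator {True} (c (j # u, i)) * ?g True c" for c
  proof -
    have "f (config u i c) = ?g (c (j # u, i)) c"
      by (rule coords_cong[OF f]) (use config_child u j in auto)
    then show ?thesis by (cases "c (j # u, i)") simp_all
  qed
  have prod: "(\<integral>\<^sup>+c. indicator {b} (c (j # u, i)) * ?g b c \<partial>noise) = p i b * (\<integral>\<^sup>+c. ?g b c \<partial>noise)"
      for b
  proof -
    let ?K = "\<lambda>h. if h then {(j # u, i)} else subtree k (j # u) (Suc 0) \<times> UNIV"
    let ?h = "\<lambda>h c. if h then indicator {b} (c (j # u, i)) else ?g b c"
    have "j # u \<notin> subtree k (j # u) (Suc 0)" by (auto simp: subtree_iff)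
    then have "(\<integral>\<^sup>+c. (\<Prod>h\<in>UNIV. ?h h c) \<partial>noise) = (\<Prod>h\<in>UNIV. \<integral>\<^sup>+c. ?h h c \<partial>noise)"
      using ju ind meas subtree_choices_subset[OF ju]
      by (intro nn_integral_prod_disjoint[where K = ?K]) (auto simp: disjoint_family_on_def)
    then show ?thesis using nn_integral_choice[OF u j] by (simp add: UNIV_bool mult.commute)
  qed
  show ?thesis
    unfolding eq by (subst nn_integral_add) (simp_all add: prod)
qed

text \<open>Given the value \<open>i\<close> of \<open>u\<close>, the subtrees of its children are independent, and the root of
  each has law \<open>p i\<close>.\<close>

lemma nn_integral_branching:
  fixes f :: "nat \<Rightarrow> _ \<Rightarrow> ennreal"
  assumes u: "u \<in> nodes k"
    and f: "\<And>j. j < k \<Longrightarrow> f j \<in> borel_measurable (coords k (subtree k (j # u) 0))"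
  shows "(\<integral>\<^sup>+c. (\<Prod>j<k. f j (config u i c)) \<partial>noise) =
    (\<Prod>j<k. p i False * (\<integral>\<^sup>+c. f j (config (j # u) False c) \<partial>noise) +
      p i True * (\<integral>\<^sup>+c. f j (config (j # u) True c) \<partial>noise))"
proof -
  have "(\<integral>\<^sup>+c. (\<Prod>j<k. f j (config u i c)) \<partial>noise) = (\<Prod>j<k. \<integral>\<^sup>+c. f j (config u i c) \<partial>noise)"
  proof (rule nn_integral_prod_disjoint[where K = "\<lambda>j. subtree k (j # u) 0 \<times> UNIV"])
    show "disjoint_family_on (\<lambda>j. subtree k (j # u) 0 \<times> (UNIV :: bool set)) {..<k}"
      using disjoint_subtrees[of k u 0 "{..<k}"] by (auto simp: disjoint_family_on_def)
  next
    fix j assume "j \<in> {..<k}"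
    then have j: "j < k" and ju: "j # u \<in> nodes k" using u by auto
    show "subtree k (j # u) 0 \<times> UNIV \<subseteq> noise_index"
      using ju by (auto simp: subtree_iff)
    have K: "subtree k (j # u) (Suc 0) \<times> UNIV \<subseteq> subtree k (j # u) 0 \<times> (UNIV :: bool set)"
      using subtree_antimono[of 0 "Suc 0" k "j # u"] by auto
    have meas: "(\<lambda>c. f j (config (j # u) b c)) \<in> borel_measurable (noise_of (subtree k (j # u) 0 \<times>
        UNIV))" for b
      using measurable_noise_of_mono[OF K measurable_compose[OF measurable_config[OF ju] f[OF j]]] .
    have "(\<lambda>c. f j (config u i c)) = (\<lambda>c. if c (j # u, i) then f j (config (j # u) True c)
        else f j (config (j # u) False c))"
    proof
      fix c
      have "f j (config u i c) = f j (config (j # u) (c (j # u, i)) c)"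
        by (rule coords_cong[OF f[OF j]]) (use config_child u j in auto)
      then show "f j (config u i c) = (if c (j # u, i) then f j (config (j # u) True c)
          else f j (config (j # u) False c))"
        by auto
    qed
    also have "\<dots> \<in> borel_measurable (noise_of (subtree k (j # u) 0 \<times> UNIV))"
      using meas measurable_choice[of "(j # u, i)" "subtree k (j # u) 0 \<times> UNIV"] self_in_subtree[of
          "j # u" k]
      by (intro measurable_If) (auto simp: pred_def)
    finally show "(\<lambda>c. f j (config u i c)) \<in> borel_measurable (noise_of (subtree k (j # u) 0 \<times> UNIV))" .
  qed simp
  also have "\<dots> = (\<Prod>j<k. p i False * (\<integral>\<^sup>+c. f j (config (j # u) False c) \<partial>noise) +
      p i True * (\<integral>\<^sup>+c. f j (config (j # u) True c) \<partial>noise))"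
    using nn_integral_branching_single[OF u _ f] by (intro prod.cong) auto
  finally show ?thesis .
qed

lemma measurable_node_value_choices:
  assumes "u \<in> nodes k"
  shows "(\<lambda>c. node_value a c u) \<in> measurable (noise_of (noise_index -
      subtree k u (Suc 0) \<times> UNIV)) (count_space UNIV)"
proof -
  have "(\<lambda>c. node_value a c x) \<in> measurable (noise_of (noise_index -
      subtree k u (Suc 0) \<times> UNIV)) (count_space UNIV)"
    if "\<exists>v. u = v @ x" for x
    using that
  proof (induction x)
    case Nil
    then show ?case by simp
  next
    case (Cons j x)
    then obtain v where v: "u = v @ j # x" by auto
    then have ux: "u = (v @ [j]) @ x" by simp
    have "(j # x, b) \<in> noise_index - subtree k u (Suc 0) \<times> UNIV" for b
      using assms v by (auto simp: subtree_iff)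
    then have c: "(\<lambda>c. c (j # x, b)) \<in> measurable (noise_of (noise_index -
        subtree k u (Suc 0) \<times> UNIV)) (count_space UNIV)" for b
      by (rule measurable_choice)
    have "(\<lambda>c. node_value a c (j # x)) = (\<lambda>c. if node_value a c x then c (j # x, True)
        else c (j # x, False))"
      by (intro ext) (simp split: if_splits)
    also have "\<dots> \<in> measurable (noise_of (noise_index - subtree k u (Suc 0) \<times> UNIV)) (count_space UNIV)"
      using Cons.IH ux c by (intro measurable_If) (auto simp: pred_def)
    finally show ?case .
  qed
  then show ?thesis by simp
qed

lemma emeasure_brw:
  assumes "A \<in> sets (config_space k)"
  shows "emeasure (brw k p) A =
    (\<integral>\<^sup>+a. emeasure noise {c \<in> space noise. (\<lambda>u\<in>nodes k. node_value a c u) \<in> A}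
        \<partial>measure_pmf (root_law p))"
proof -
  let ?F = "\<lambda>(a, c). \<lambda>u\<in>nodes k. node_value a c u"
  have ch: "choices k p = measure_pmf (root_law p) \<Otimes>\<^sub>M noise"
    by (simp add: choices_def noise_def)
  have "emeasure (brw k p) A = emeasure (choices k p) (?F -` A \<inter> space (choices k p))"
    unfolding brw_def by (rule emeasure_distr[OF measurable_brw assms])
  also have "\<dots> = (\<integral>\<^sup>+a. emeasure noise (Pair a -` (?F -` A \<inter> space (choices k p)))
      \<partial>measure_pmf (root_law p))"
    unfolding ch using measurable_sets[OF measurable_brw assms, of p] unfolding ch
    by (rule noise.emeasure_pair_measure_alt)
  also have "\<dots> = (\<integral>\<^sup>+a. emeasure noise {c \<in> space noise. (\<lambda>u\<in>nodes k. node_value a c u) \<in> A}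
      \<partial>measure_pmf (root_law p))"
    by (intro nn_integral_cong arg_cong2[where f = emeasure]) (auto simp: ch space_pair_measure)
  finally show ?thesis .
qed

text \<open>Conditioning agrees with forcing: the value at \<open>u\<close> depends on the choices at \<open>u\<close> and its
  ancestors, while the forced subtree depends on those strictly below \<open>u\<close>. This transfers what
  is shown for forced subtrees to the branching random walk.\<close>

lemma emeasure_brw_subtree:
  assumes u: "u \<in> nodes k" and S: "S \<in> sets (coords k (subtree k u 0))"
  shows "emeasure (brw k p) {\<phi> \<in> S. \<phi> u = i} =
    emeasure (brw k p) {\<phi> \<in> space (config_space k). \<phi> u = i} *
        emeasure noise {c \<in> space noise. config u i c \<in> S}"
proof -
  have sub: "sets (coords k (subtree k u 0)) \<subseteq> sets (config_space k)"
    unfolding sets_coords by (rule coord_algebra_subset[OF subtree_subset_nodes[OF u]])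
  have val: "{\<phi> \<in> space (config_space k). \<phi> u = i} \<in> sets (coords k (subtree k u 0))"
    using measurable_sets[OF measurable_coord[OF self_in_subtree[of u k]], of "{i}"]
    by (auto simp: vimage_def Int_def conj_commute)
  have S': "{\<phi> \<in> S. \<phi> u = i} = S \<inter> {\<phi> \<in> space (config_space k). \<phi> u = i}"
    using sets.sets_into_space[OF S] by auto
  have Si: "{\<phi> \<in> S. \<phi> u = i} \<in> sets (coords k (subtree k u 0))"
    unfolding S' using S val by (rule sets.Int)
  let ?K = "noise_index - subtree k u (Suc 0) \<times> UNIV"
  have one: "emeasure noise {c \<in> space noise. (\<lambda>u\<in>nodes k. node_value a c u) \<in> {\<phi> \<in> S. \<phi> u = i}} =
      emeasure noise {c \<in> space noise. node_value a c u = i} *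
          emeasure noise {c \<in> space noise. config u i c \<in> S}" for a
  proof -
    have A1: "{c \<in> space noise. node_value a c u = i} \<in> sets (noise_of ?K)"
      using measurable_sets[OF measurable_node_value_choices[OF u, of a], of "{i}"]
      by (auto simp: vimage_def Int_def conj_commute)
    have A2: "{c \<in> space noise. config u i c \<in> S} \<in> sets (noise_of (subtree k u (Suc 0) \<times> UNIV))"
      using measurable_sets[OF measurable_config[OF u] S, of i]
      by (auto simp: vimage_def Int_def conj_commute)
    have agree: "(\<lambda>u\<in>nodes k. node_value a c u) \<in> S \<longleftrightarrow> config u i c \<in> S" if "node_value a c u = i" for c
      by (rule coords_cong_set[OF S])
        (use u that in \<open>auto simp: space_config_space subtree_iff config_def
            node_value_eq_forced_value[of a c _ u]\<close>)
    let ?A = "\<lambda>h. if h then {c \<in> space noise. node_value a c u = i}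
        else {c \<in> space noise. config u i c \<in> S}"
    let ?L = "\<lambda>h. if h then ?K else subtree k u (Suc 0) \<times> UNIV"
    have A: "?A h \<in> sets (noise_of (?L h))" for h using A1 A2 by auto
    have L: "?L h \<subseteq> noise_index" for h using subtree_choices_subset[OF u] by auto
    have AN: "?A h \<in> sets noise" for h using A[of h] sets_noise_of_subset[OF L[of h]]
        by (rule subsetD[rotated])
    have "(\<integral>\<^sup>+c. (\<Prod>h\<in>UNIV. indicator (?A h) c) \<partial>noise) = (\<Prod>h\<in>UNIV. \<integral>\<^sup>+c. indicator (?A h) c \<partial>noise)"
      using A L by (intro nn_integral_prod_disjoint[where K = ?L]) (auto simp: disjoint_family_on_def)
    also have "\<dots> = (\<Prod>h\<in>UNIV. emeasure noise (?A h))"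
      using AN by (intro prod.cong nn_integral_indicator) auto
    also have "(\<lambda>c. \<Prod>h\<in>UNIV. indicator (?A h) c :: ennreal) = indicator (?A True \<inter> ?A False)"
      by (auto simp: fun_eq_iff UNIV_bool indicator_def)
    also have "(\<integral>\<^sup>+c. indicator (?A True \<inter> ?A False) c \<partial>noise) = emeasure noise (?A True \<inter> ?A False)"
      using AN[of True] AN[of False] by (intro nn_integral_indicator sets.Int) auto
    also have "?A True \<inter> ?A False = {c \<in> space noise. (\<lambda>u\<in>nodes k. node_value a c u) \<in> {\<phi> \<in> S. \<phi> u =
        i}}"
      using agree u by auto
    finally show ?thesis by (simp add: UNIV_bool mult.commute)
  qed
  have "emeasure (brw k p) {\<phi> \<in> S. \<phi> u = i} =
      (\<integral>\<^sup>+a. emeasure noise {c \<in> space noise. node_value a c u = i} *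
      emeasure noise {c \<in> space noise. config u i c \<in> S} \<partial>measure_pmf (root_law p))"
    using Si sub by (subst emeasure_brw) (auto simp: one[simplified])
  also have "\<dots> = (\<integral>\<^sup>+a. emeasure noise {c \<in> space noise. node_value a c u = i}
      \<partial>measure_pmf (root_law p)) *
      emeasure noise {c \<in> space noise. config u i c \<in> S}"
    by (rule nn_integral_multc) simp
  also have "(\<integral>\<^sup>+a. emeasure noise {c \<in> space noise. node_value a c u = i} \<partial>measure_pmf (root_law p)) =
      emeasure (brw k p) {\<phi> \<in> space (config_space k). \<phi> u = i}"
    using val sub u by (subst emeasure_brw) (auto simp: space_config_space)
  finally show ?thesis .
qed

end

section \<open>Elementary inequalities\<close>

lemma convex_ln_one_plus_exp:
  fixes w :: real
  assumes "w > 0"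
  shows "convex_on UNIV (\<lambda>t. ln (1 + w * exp t))"
proof (rule f''_ge0_imp_convex)
  fix t :: real
  have pos: "1 + w * exp t > 0" using assms by (intro add_pos_pos) auto
  show "((\<lambda>t. ln (1 + w * exp t)) has_real_derivative w * exp t / (1 + w * exp t)) (at t)"
    using pos by (auto intro!: derivative_eq_intros)
  show "((\<lambda>t. w * exp t / (1 + w * exp t)) has_real_derivative w * exp t / (1 + w * exp t)\<^sup>2) (at t)"
    using pos by (auto intro!: derivative_eq_intros simp: field_simps power2_eq_square)
  show "0 \<le> w * exp t / (1 + w * exp t)\<^sup>2" using assms by simp
qed simp

text \<open>With \<open>t = ln r\<close> this compares slopes of secants through \<open>0\<close> of the convex function
  \<open>t \<mapsto> ln (1 + w exp t)\<close>: the slope is largest at the right end \<open>ln \<rho>\<close>. Multiplying by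
  \<open>r - 1\<close>, which has the sign of \<open>t\<close>, unites the cases \<open>t > 0\<close> and \<open>t < 0\<close>.\<close>

lemma secant_bound:
  fixes w r \<rho> :: real
  assumes w: "w > 0" and \<rho>: "\<rho> > 1" and r: "0 < r" "r \<le> \<rho>"
  shows "(r - 1) * ln ((1 + w * r) / (1 + w))
    \<le> ln ((1 + w * \<rho>) / (1 + w)) / ln \<rho> * ((r - 1) * ln r)"
proof -
  define g where "g t = ln (1 + w * exp t)" for t
  have conv: "convex_on UNIV g"
    unfolding g_def using w by (rule convex_ln_one_plus_exp)
  define T where "T = ln \<rho>"
  define t where "t = ln r"
  have T: "T > 0" and t: "t \<le> T" using \<rho> r by (simp_all add: T_def t_def)
  define s where "s = (g T - g 0) / T"
  have g0: "g 0 = ln (1 + w)" by (simp add: g_def)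
  have pos: "1 + w * x > 0" if "x > 0" for x :: real
    using w that by (intro add_pos_pos) auto
  have gt: "ln ((1 + w * r) / (1 + w)) = g t - g 0"
    using w r pos[of r] by (simp add: g_def t_def ln_div)
  have gT: "ln ((1 + w * \<rho>) / (1 + w)) = g T - g 0"
    using w \<rho> pos[of \<rho>] by (simp add: g_def T_def ln_div)
  have "(r - 1) * (g t - g 0) \<le> (r - 1) * (s * t)"
  proof (cases "t \<ge> 0")
    case True
    have "g ((1 - t / T) *\<^sub>R 0 + (t / T) *\<^sub>R T) \<le> (1 - t / T) * g 0 + (t / T) * g T"
      using T t True by (intro convex_onD[OF conv]) auto
    then have "g t - g 0 \<le> s * t" using T by (simp add: s_def field_simps)
    moreover have "r \<ge> 1" using True r by (simp add: t_def)
    ultimately show ?thesis by (intro mult_left_mono) auto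
  next
    case False
    \<comment> \<open>the weight that makes \<open>0\<close> a convex combination of \<open>t\<close> and \<open>T\<close>\<close>
    define q where "q = - t / (T - t)"
    have q: "0 \<le> q" "q \<le> 1" using False T by (simp_all add: q_def field_simps)
    have "(1 - q) *\<^sub>R t + q *\<^sub>R T = 0" using False T by (simp add: q_def field_simps)
    then have "g 0 \<le> (1 - q) * g t + q * g T"
      using convex_onD[OF conv q, of t T] by simp
    then have "(T - t) * g 0 \<le> (T - t) * ((1 - q) * g t + q * g T)"
      using False T by (intro mult_left_mono) auto
    also have "\<dots> = (T - t) * g t - ((T - t) * q) * g t + ((T - t) * q) * g T"
      by (simp add: algebra_simps)
    also have "(T - t) * q = - t" using False T by (simp add: q_def)
    also have "(T - t) * g t - (- t) * g t + (- t) * g T = T * g t - t * g T"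
      by (simp add: algebra_simps)
    finally have "s * t \<le> g t - g 0" using T by (simp add: s_def field_simps)
    moreover have "r \<le> 1" using False r by (simp add: t_def)
    ultimately show ?thesis by (intro mult_left_mono_neg) auto
  qed
  then show ?thesis unfolding gt gT s_def T_def t_def by (simp add: mult_ac)
qed

text \<open>The divergence \<open>(r - 1) ln r\<close> of a bounded likelihood ratio controls its variance.\<close>

lemma square_le_mult_ln:
  fixes r \<rho> :: real
  assumes "0 < r" "r \<le> \<rho>" "1 \<le> \<rho>"
  shows "(r - 1)\<^sup>2 \<le> \<rho> * ((r - 1) * ln r)"
proof (cases "r \<ge> 1")
  case True
  have "ln (1 / r) \<le> 1 / r - 1" using assms by (intro ln_le_minus_one) auto
  then have "1 - 1 / r \<le> ln r" using assms by (simp add: ln_div)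
  then have "r * (1 - 1 / r) \<le> r * ln r" using assms by (intro mult_left_mono) auto
  moreover have "r * (1 - 1 / r) = r - 1" using assms by (simp add: right_diff_distrib)
  ultimately have "r - 1 \<le> r * ln r" by simp
  also have "\<dots> \<le> \<rho> * ln r" using assms True by (intro mult_right_mono) auto
  finally have "(r - 1) * (r - 1) \<le> (r - 1) * (\<rho> * ln r)" using True by (intro mult_left_mono) auto
  then show ?thesis by (simp add: power2_eq_square mult_ac)
next
  case False
  have "ln r \<le> r - 1" using assms by (intro ln_le_minus_one)
  then have "(r - 1) * (r - 1) \<le> (r - 1) * ln r" using False by (intro mult_left_mono_neg) auto
  also have "\<dots> \<le> \<rho> * ((r - 1) * ln r)"
    using mult_right_mono[OF \<open>1 \<le> \<rho>\<close>, of "(r - 1) * ln r"] False assms by (simp add: mult_nonpos_nonpos)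
  finally show ?thesis by (simp add: power2_eq_square)
qed

lemma abs_ln_le:
  fixes a b x :: real
  assumes "0 < a" "a \<le> x" "x \<le> b"
  shows "\<bar>ln x\<bar> \<le> \<bar>ln a\<bar> + \<bar>ln b\<bar>"
proof -
  have "ln a \<le> ln x" "ln x \<le> ln b" using assms by auto
  then show ?thesis by linarith
qed

section \<open>Likelihood ratios\<close>

text \<open>Let \<open>u\<close> be a child of a node of value \<open>0\<close>. Then \<open>zero_density k w d u\<close> is the density, on
  the levels at distance at least \<open>d\<close> below \<open>u\<close>, of the law forced to \<open>0\<close> at \<open>u\<close> with respect
  to the mixture with weights \<open>1 / (1 + w)\<close> and \<open>w / (1 + w)\<close> of the laws forced to \<open>0\<close> and to
  \<open>1\<close>. Starting from this density rather than from the ratio of the two forced laws avoids an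
  infinite value at \<open>d = 0\<close>, where the two laws are mutually singular.\<close>

primrec zero_density :: "nat \<Rightarrow> real \<Rightarrow> nat \<Rightarrow> nat list \<Rightarrow> (nat list \<Rightarrow> bool) \<Rightarrow> real" where
  "zero_density k w 0 u \<phi> = (if \<phi> u then 0 else 1 + w)"
| "zero_density k w (Suc d) u \<phi> = (1 + w) / (1 + w * (\<Prod>j<k. zero_density k w d (j # u) \<phi>))"

locale hardcore =
  fixes k :: nat and w :: real
  assumes k: "k \<ge> 1" and w: "w > 0"
begin

sublocale broadcast k "hardcore_matrix w"
  using stochastic_hardcore_matrix[OF w] by unfold_locales

abbreviation Z :: "nat \<Rightarrow> nat list \<Rightarrow> (nat list \<Rightarrow> bool) \<Rightarrow> real" where
  "Z \<equiv> zero_density k w"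

text \<open>The density of the law forced to \<open>1\<close> with respect to the law forced to \<open>0\<close>, on the levels at
  distance at least \<open>Suc d\<close> below \<open>u\<close>: under the former all children have value \<open>0\<close>, under the
  latter each child follows the mixture. With \<open>Y = w * likelihood_ratio\<close> the recursion takes
  the usual form \<open>Y = w (1 + w)\<^sup>k / (\<Prod>j<k. 1 + Y\<^sub>j)\<close> of the hard-core model.\<close>

definition likelihood_ratio :: "nat \<Rightarrow> nat list \<Rightarrow> (nat list \<Rightarrow> bool) \<Rightarrow> real" where
  "likelihood_ratio d u \<phi> = (\<Prod>j<k. Z d (j # u) \<phi>)"

lemma Z_Suc: "Z (Suc d) u \<phi> = (1 + w) / (1 + w * likelihood_ratio d u \<phi>)"
  by (simp add: likelihood_ratio_def)

declare zero_density.simps(2) [simp del]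

lemma Z_bounds: "0 \<le> Z d u \<phi>" "Z d u \<phi> \<le> 1 + w"
proof -
  have "0 \<le> Z d u \<phi> \<and> Z d u \<phi> \<le> 1 + w"
  proof (induction d arbitrary: u)
    case 0
    then show ?case using w by simp
  next
    case (Suc d)
    then have r: "0 \<le> likelihood_ratio d u \<phi>" unfolding likelihood_ratio_def by (intro prod_nonneg) auto
    then have "1 \<le> 1 + w * likelihood_ratio d u \<phi>" using w by simp
    then have "(1 + w) / (1 + w * likelihood_ratio d u \<phi>) \<le> (1 + w) / 1"
      using w by (intro divide_left_mono) auto
    then show ?case using w r by (simp add: Z_Suc)
  qed
  then show "0 \<le> Z d u \<phi>" "Z d u \<phi> \<le> 1 + w" by auto
qed

lemma ratio_nonneg: "0 \<le> likelihood_ratio d u \<phi>"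
  unfolding likelihood_ratio_def by (intro prod_nonneg) (auto simp: Z_bounds)

lemma ratio_le: "likelihood_ratio d u \<phi> \<le> (1 + w) ^ k"
proof -
  have "likelihood_ratio d u \<phi> \<le> (\<Prod>j<k. 1 + w)"
    unfolding likelihood_ratio_def by (intro prod_mono) (auto simp: Z_bounds)
  then show ?thesis by simp
qed

lemma Z_Suc_ge: "(1 + w) / (1 + w * (1 + w) ^ k) \<le> Z (Suc d) u \<phi>"
  unfolding Z_Suc using w ratio_nonneg[of d u \<phi>] ratio_le[of d u \<phi>]
  by (intro divide_left_mono) (auto intro!: mult_pos_pos add_pos_nonneg)

lemma Z_Suc_pos: "0 < Z (Suc d) u \<phi>"
  using w ratio_nonneg[of d u \<phi>] by (auto simp: Z_Suc intro!: divide_pos_pos add_pos_nonneg)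

text \<open>A likelihood ratio of index \<open>0\<close> vanishes when some child has value \<open>1\<close>; from index \<open>1\<close> on
  it is bounded away from \<open>0\<close>, so that its logarithm is bounded.\<close>

definition ratio_min :: real where
  "ratio_min = ((1 + w) / (1 + w * (1 + w) ^ k)) ^ k"

lemma ratio_min_pos: "0 < ratio_min"
  unfolding ratio_min_def using w by (intro zero_less_power divide_pos_pos add_pos_nonneg) auto

lemma ratio_Suc_ge: "ratio_min \<le> likelihood_ratio (Suc d) u \<phi>"
proof -
  have "(\<Prod>j<k. (1 + w) / (1 + w * (1 + w) ^ k)) \<le> likelihood_ratio (Suc d) u \<phi>"
    unfolding likelihood_ratio_def using w Z_Suc_ge by (intro prod_mono) (auto
        intro!: divide_nonneg_nonneg add_nonneg_nonneg)
  then show ?thesis by (simp add: ratio_min_def)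
qed

lemma ratio_Suc_pos: "0 < likelihood_ratio (Suc d) u \<phi>"
  using ratio_min_pos ratio_Suc_ge by (rule less_le_trans)

lemma measurable_Z: "Z d u \<in> borel_measurable (coords k (subtree k u d))"
proof (induction d arbitrary: u)
  case 0
  have "(\<lambda>\<phi>. if \<phi> u then 0 else 1 + w) \<in> borel_measurable (coords k (subtree k u 0))"
    using measurable_coord[OF self_in_subtree[of u k]] by (intro measurable_If) (auto simp: pred_def)
  then show ?case by (simp cong: measurable_cong)
next
  case (Suc d)
  have "Z d (j # u) \<in> borel_measurable (coords k (subtree k u (Suc d)))" if "j < k" for j
    by (rule measurable_coords_mono[OF _ Suc]) (use that in \<open>auto simp: subtree_Suc\<close>)
  then have "(\<lambda>\<phi>. (1 + w) / (1 + w * (\<Prod>j<k. Z d (j # u) \<phi>))) \<in> borel_measurable (coords k (subtree k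
      u (Suc d)))"
    by (intro borel_measurable_divide borel_measurable_add borel_measurable_times
        borel_measurable_prod) auto
  then show ?case by (simp add: zero_density.simps(2) cong: measurable_cong)
qed

lemma measurable_ratio: "likelihood_ratio d u \<in> borel_measurable (coords k (subtree k u (Suc d)))"
proof -
  have "Z d (j # u) \<in> borel_measurable (coords k (subtree k u (Suc d)))" if "j < k" for j
    by (rule measurable_coords_mono[OF _ measurable_Z]) (use that in \<open>auto simp: subtree_Suc\<close>)
  then show ?thesis unfolding likelihood_ratio_def[abs_def] by (intro borel_measurable_prod) auto
qed

text \<open>The defining property of the density, with the mixture written out.\<close>

definition is_zero_density :: "nat \<Rightarrow> nat list \<Rightarrow> bool" where
  "is_zero_density d u \<longleftrightarrow> (\<forall>f\<in>borel_measurable (coords k (subtree k u d)).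
     (\<integral>\<^sup>+c. f (config u False c) \<partial>noise) =
       ennreal (1 / (1 + w)) * (\<integral>\<^sup>+c. ennreal (Z d u (config u False c)) * f (config u False c)
           \<partial>noise) +
       ennreal (w / (1 + w)) * (\<integral>\<^sup>+c. ennreal (Z d u (config u True c)) * f (config u True c) \<partial>noise))"

text \<open>Both sides are finite measures, so it is enough to compare them on intersections of one event
  per child subtree. There the branching property turns either side into a product over the
  children, and the factors agree by the property of the densities of the children.\<close>

lemma distr_True_eq_density:
  assumes u: "u \<in> nodes k" and IH: "\<And>j. j < k \<Longrightarrow> is_zero_density d (j # u)"
  defines "G \<equiv> coords k (subtree k u (Suc d))"
  shows "distr noise G (config u True) = density (distr noise G (config u False))
      (\<lambda>\<phi>. ennreal (likelihood_ratio d u \<phi>))"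
proof -
  let ?\<Omega> = "space (config_space k)"
  let ?C = "\<lambda>j. coords k (subtree k (j # u) d)"
  define E where "E = {?\<Omega> \<inter> (\<Inter>j<k. S j) | S. \<forall>j<k. S j \<in> sets (?C j)}"
  have sub: "sets (?C j) \<subseteq> sets G" if "j < k" for j
    unfolding G_def sets_coords coord_algebra_def subtree_Suc using that
    by (intro sigma_sets_subseteq Collect_mono impI) (elim exE conjE, intro exI conjI, assumption,
        blast)
  have EG: "E \<subseteq> sets G"
  proof
    fix X assume "X \<in> E"
    then obtain S where S: "\<And>j. j < k \<Longrightarrow> S j \<in> sets (?C j)" and X: "X = ?\<Omega> \<inter> (\<Inter>j<k. S j)"
      unfolding E_def by blast
    have "(\<Inter>j<k. S j) \<in> sets G"
      by (rule sets.finite_INT) (use k S sub in \<open>auto simp: lessThan_empty_iff\<close>)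
    then show "X \<in> sets G" unfolding X using sets.top[of G] by (auto simp: G_def)
  qed
  have sets_G: "sets G = sigma_sets ?\<Omega> E"
  proof
    show "sigma_sets ?\<Omega> E \<subseteq> sets G"
      using sets.sigma_sets_subset[OF EG] by (simp add: G_def)
    show "sets G \<subseteq> sigma_sets ?\<Omega> E"
      unfolding G_def sets_coords coord_algebra_def
    proof (rule sigma_sets_mono, rule subsetI)
      fix X assume "X \<in> {(\<lambda>\<phi>. \<phi> v) -` B \<inter> ?\<Omega> | v B. v \<in> subtree k u (Suc d)}"
      then obtain v B where v: "v \<in> subtree k u (Suc d)" and X: "X = (\<lambda>\<phi>. \<phi> v) -` B \<inter> ?\<Omega>"
        by (simp only: mem_Collect_eq) (elim exE conjE)
      from v obtain j where j: "j < k" "v \<in> subtree k (j # u) d" by (auto simp: subtree_Suc)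
      define S where "S l = (if l = j then X else ?\<Omega>)" for l
      have "X \<in> sets (?C j)"
        using measurable_sets[OF measurable_coord[OF j(2), of k], of B] by (simp add: X)
      then have "\<forall>l<k. S l \<in> sets (?C l)"
        using sets.top[of "?C l" for l] by (auto simp: S_def)
      moreover have "X = ?\<Omega> \<inter> (\<Inter>l<k. S l)"
        using j(1) by (auto simp: S_def X split: if_splits)
      ultimately have "X \<in> E" unfolding E_def by blast
      then show "X \<in> sigma_sets ?\<Omega> E" by (rule sigma_sets.Basic)
    qed
  qed
  have mG: "config u i \<in> measurable noise G" for i
    unfolding G_def by (rule measurable_config_noise[OF u])
  have mr: "(\<lambda>\<phi>. ennreal (likelihood_ratio d u \<phi>)) \<in> borel_measurable G"
    unfolding G_def using measurable_ratio by measurable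
  show ?thesis
  proof (rule measure_eqI_generator_eq[where E = E and \<Omega> = ?\<Omega> and A = "\<lambda>_. ?\<Omega>"])
    show "Int_stable E"
    proof (rule Int_stableI)
      fix X Y assume "X \<in> E" "Y \<in> E"
      then obtain S S' where S: "\<And>j. j < k \<Longrightarrow> S j \<in> sets (?C j)" "X = ?\<Omega> \<inter> (\<Inter>j<k. S j)"
        and S': "\<And>j. j < k \<Longrightarrow> S' j \<in> sets (?C j)" "Y = ?\<Omega> \<inter> (\<Inter>j<k. S' j)"
        unfolding E_def by blast
      have "X \<inter> Y = ?\<Omega> \<inter> (\<Inter>j<k. S j \<inter> S' j)" using S(2) S'(2) by auto
      moreover have "\<forall>j<k. S j \<inter> S' j \<in> sets (?C j)" using S(1) S'(1) by auto
      ultimately show "X \<inter> Y \<in> E"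
        unfolding E_def by (intro CollectI exI[of _ "\<lambda>j. S j \<inter> S' j"]) auto
    qed
    show "E \<subseteq> Pow ?\<Omega>" by (auto simp: E_def)
    have "\<forall>j<k. ?\<Omega> \<in> sets (?C j)" using sets.top[of "?C j" for j] by auto
    then show "range (\<lambda>_. ?\<Omega>) \<subseteq> E"
      unfolding E_def by (intro image_subsetI CollectI exI[of _ "\<lambda>_. ?\<Omega>"]) auto
    have "prob_space (distr noise G (config u True))" by (rule noise.prob_space_distr[OF mG])
    then show "emeasure (distr noise G (config u True)) ?\<Omega> \<noteq> \<infinity>"
      by (simp add: prob_space.emeasure_space_1 finite_measure.emeasure_finite
          prob_space.finite_measure)
    fix X assume XE: "X \<in> E"
    then obtain S where S: "\<And>j. j < k \<Longrightarrow> S j \<in> sets (?C j)" and X: "X = ?\<Omega> \<inter> (\<Inter>j<k. S j)"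
      unfolding E_def by blast
    have XG: "X \<in> sets G" using XE EG by blast
    have ind: "indicator X (config u i c) = (\<Prod>j<k. indicator (S j) (config u i c) :: ennreal)" for i c
    proof -
      have "(\<Prod>j<k. indicator (S j) (config u i c) :: ennreal) = indicator (\<Inter>j<k. S j) (config u i c)"
        by (cases "\<forall>j<k. config u i c \<in> S j") (auto simp: indicator_def intro!: prod.neutral prod_zero)
      then show ?thesis by (auto simp: X indicator_def)
    qed
    have mS: "indicator (S j) \<in> borel_measurable (coords k (subtree k (j # u) 0))" if "j < k" for j
      by (rule measurable_coords_mono[OF subtree_antimono borel_measurable_indicator[OF S[OF
          that]]]) simp
    have mZ: "Z d (j # u) \<in> borel_measurable (coords k (subtree k (j # u) 0))" for j
      by (rule measurable_coords_mono[OF subtree_antimono measurable_Z]) simp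
    \<comment> \<open>under the law forced to \<open>1\<close> every child has value \<open>0\<close>; the children then become mixtures
        weighted by their densities\<close>
    have "emeasure (distr noise G (config u True)) X = (\<integral>\<^sup>+\<phi>. indicator X \<phi>
        \<partial>distr noise G (config u True))"
      using XG by simp
    also have "\<dots> = (\<integral>\<^sup>+c. indicator X (config u True c) \<partial>noise)"
      using XG by (intro nn_integral_distr[OF mG]) auto
    also have "\<dots> = (\<integral>\<^sup>+c. (\<Prod>j<k. indicator (S j) (config u True c)) \<partial>noise)"
      unfolding ind ..
    also have "\<dots> = (\<Prod>j<k. \<integral>\<^sup>+c. indicator (S j) (config (j # u) False c) \<partial>noise)"
      by (subst nn_integral_branching[OF u mS]) (auto simp: hardcore_matrix_def)
    also have "\<dots> = (\<Prod>j<k. ennreal (1 / (1 + w)) *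
          (\<integral>\<^sup>+c. ennreal (Z d (j # u) (config (j # u) False c)) *
              indicator (S j) (config (j # u) False c) \<partial>noise) +
        ennreal (w / (1 + w)) *
          (\<integral>\<^sup>+c. ennreal (Z d (j # u) (config (j # u) True c)) *
              indicator (S j) (config (j # u) True c) \<partial>noise))"
      using IH S by (intro prod.cong refl) (auto simp: is_zero_density_def)
    also have "\<dots> = (\<integral>\<^sup>+c. (\<Prod>j<k. ennreal (Z d (j # u) (config u False c)) *
        indicator (S j) (config u False c)) \<partial>noise)"
      by (subst nn_integral_branching[OF u, where f = "\<lambda>j \<phi>. ennreal (Z d (j # u) \<phi>) *
          indicator (S j) \<phi>"])
        (use mS mZ in \<open>auto simp: hardcore_matrix_def
            intro!: borel_measurable_times_ennreal measurable_compose[OF mZ]\<close>)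
    also have "\<dots> = (\<integral>\<^sup>+c. ennreal (likelihood_ratio d u (config u False c)) *
        indicator X (config u False c) \<partial>noise)"
      unfolding ind prod.distrib by (simp add: likelihood_ratio_def prod_ennreal Z_bounds)
    also have "\<dots> = (\<integral>\<^sup>+\<phi>. ennreal (likelihood_ratio d u \<phi>) * indicator X \<phi>
        \<partial>distr noise G (config u False))"
      using XG mr by (intro nn_integral_distr[OF mG, symmetric]) auto
    also have "\<dots> = emeasure (density (distr noise G (config u False))
        (\<lambda>\<phi>. ennreal (likelihood_ratio d u \<phi>))) X"
      using XG mr by (intro emeasure_density[symmetric]) auto
    finally show "emeasure (distr noise G (config u True)) X =
      emeasure (density (distr noise G (config u False)) (\<lambda>\<phi>. ennreal (likelihood_ratio d u \<phi>))) X" .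
  qed (auto simp: sets_G)
qed

text \<open>At \<open>d = 0\<close> the value of \<open>u\<close> itself is visible and decides between the two laws. Afterwards
  the density is \<open>1 / (1 / (1 + w) + w / (1 + w) R)\<close> for the ratio \<open>R\<close> of the two forced
  laws.\<close>

lemma zero_density_law:
  assumes "u \<in> nodes k"
  shows "is_zero_density d u"
  using assms
proof (induction d arbitrary: u)
  case 0
  have inv: "ennreal (1 / (1 + w)) * (ennreal (1 + w) * x) = x" for x
  proof -
    have "ennreal (1 / (1 + w)) * ennreal (1 + w) = 1"
      using w by (subst ennreal_mult[symmetric]) auto
    then show ?thesis by (simp add: mult.assoc[symmetric] del: ennreal_plus)
  qed
  show ?case unfolding is_zero_density_def
  proof
    fix f :: "_ \<Rightarrow> ennreal" assume f: "f \<in> borel_measurable (coords k (subtree k u 0))"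
    have [measurable]: "(\<lambda>c. f (config u False c)) \<in> borel_measurable noise"
      by (rule measurable_compose[OF measurable_config_noise[OF 0] f])
    show "(\<integral>\<^sup>+c. f (config u False c) \<partial>noise) =
       ennreal (1 / (1 + w)) * (\<integral>\<^sup>+c. ennreal (Z 0 u (config u False c)) * f (config u False c)
           \<partial>noise) +
       ennreal (w / (1 + w)) * (\<integral>\<^sup>+c. ennreal (Z 0 u (config u True c)) * f (config u True c) \<partial>noise)"
      using 0 by (simp add: nn_integral_cmult inv del: ennreal_plus)
  qed
next
  case (Suc d)
  define G where "G = coords k (subtree k u (Suc d))"
  have D: "distr noise G (config u True) = density (distr noise G (config u False))
      (\<lambda>\<phi>. ennreal (likelihood_ratio d u \<phi>))"
    unfolding G_def using Suc by (intro distr_True_eq_density) auto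
  show ?case unfolding is_zero_density_def G_def[symmetric]
  proof
    fix f :: "_ \<Rightarrow> ennreal" assume f [measurable]: "f \<in> borel_measurable G"
    have mG [measurable]: "config u i \<in> measurable noise G" for i
      unfolding G_def by (rule measurable_config_noise[OF Suc.prems])
    have mr [measurable]: "likelihood_ratio d u \<in> borel_measurable G"
      unfolding G_def by (rule measurable_ratio)
    have mZ [measurable]: "Z (Suc d) u \<in> borel_measurable G"
      unfolding G_def by (rule measurable_Z)
    let ?g = "\<lambda>\<phi>. ennreal (Z (Suc d) u \<phi>) * f \<phi>"
    have "(\<integral>\<^sup>+c. ?g (config u True c) \<partial>noise) = integral\<^sup>N (distr noise G (config u True)) ?g"
      by (rule nn_integral_distr[symmetric]) measurable
    also have "\<dots> = (\<integral>\<^sup>+\<phi>. ennreal (likelihood_ratio d u \<phi>) * ?g \<phi> \<partial>distr noise G (config u False))"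
      unfolding D by (rule nn_integral_density) (simp_all, measurable)
    also have "\<dots> = (\<integral>\<^sup>+c. ennreal (likelihood_ratio d u (config u False c)) * ?g (config u False c)
        \<partial>noise)"
      by (rule nn_integral_distr) measurable
    finally have T: "(\<integral>\<^sup>+c. ?g (config u True c) \<partial>noise) =
      (\<integral>\<^sup>+c. ennreal (likelihood_ratio d u (config u False c)) * ?g (config u False c) \<partial>noise)" .
    have one: "ennreal (1 / (1 + w)) * ?g \<phi> + ennreal (w / (1 + w)) *
        (ennreal (likelihood_ratio d u \<phi>) * ?g \<phi>) = f \<phi>" for \<phi>
    proof -
      have r: "0 \<le> likelihood_ratio d u \<phi>" by (rule ratio_nonneg)
      have pos: "1 + w * likelihood_ratio d u \<phi> > 0" using w r by (intro add_pos_nonneg) auto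
      have "1 / (1 + w) * Z (Suc d) u \<phi> + w / (1 + w) * (likelihood_ratio d u \<phi> * Z (Suc d) u \<phi>) =
        (1 + w * likelihood_ratio d u \<phi>) / (1 + w) * Z (Suc d) u \<phi>"
        by (simp add: algebra_simps add_divide_distrib)
      also have "\<dots> = 1" using w pos by (simp add: Z_Suc)
      finally have eq: "1 / (1 + w) * Z (Suc d) u \<phi> + w / (1 + w) * (likelihood_ratio d u \<phi> *
          Z (Suc d) u \<phi>) = 1" .
      have "ennreal (1 / (1 + w)) * ennreal (Z (Suc d) u \<phi>) + ennreal (w / (1 + w)) *
          (ennreal (likelihood_ratio d u \<phi>) * ennreal (Z (Suc d) u \<phi>))
        = ennreal (1 / (1 + w) * Z (Suc d) u \<phi> + w / (1 + w) * (likelihood_ratio d u \<phi> *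
            Z (Suc d) u \<phi>))"
        using w r Z_bounds(1)[of "Suc d" u \<phi>]
            by (simp add: ennreal_mult ennreal_plus del: times_divide_eq_left)
      then have "(ennreal (1 / (1 + w)) * ennreal (Z (Suc d) u \<phi>) + ennreal (w / (1 + w)) *
          (ennreal (likelihood_ratio d u \<phi>) * ennreal (Z (Suc d) u \<phi>))) * f \<phi> = f \<phi>"
        unfolding eq by simp
      then show ?thesis by (simp add: distrib_right mult.assoc)
    qed
    have "(\<integral>\<^sup>+c. f (config u False c) \<partial>noise) = (\<integral>\<^sup>+c. ennreal (1 / (1 + w)) * ?g (config u False c) +
      ennreal (w / (1 + w)) * (ennreal (likelihood_ratio d u (config u False c)) *
          ?g (config u False c)) \<partial>noise)"
      unfolding one ..
    also have "\<dots> = ennreal (1 / (1 + w)) * (\<integral>\<^sup>+c. ?g (config u False c) \<partial>noise) +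
       ennreal (w / (1 + w)) * (\<integral>\<^sup>+c. ennreal (likelihood_ratio d u (config u False c)) *
           ?g (config u False c) \<partial>noise)"
      by (subst nn_integral_add) (measurable, simp add: nn_integral_cmult)
    finally show "(\<integral>\<^sup>+c. f (config u False c) \<partial>noise) =
       ennreal (1 / (1 + w)) * (\<integral>\<^sup>+c. ?g (config u False c) \<partial>noise) +
       ennreal (w / (1 + w)) * (\<integral>\<^sup>+c. ?g (config u True c) \<partial>noise)"
      unfolding T .
  qed
qed

lemma integral_True:
  fixes f :: "_ \<Rightarrow> real"
  assumes u: "u \<in> nodes k" and f: "f \<in> borel_measurable (coords k (subtree k u (Suc d)))"
  shows "(\<integral>c. f (config u True c) \<partial>noise) = (\<integral>c. likelihood_ratio d u (config u False c) *
      f (config u False c) \<partial>noise)"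
proof -
  define G where "G = coords k (subtree k u (Suc d))"
  have D: "distr noise G (config u True) = density (distr noise G (config u False))
      (\<lambda>\<phi>. ennreal (likelihood_ratio d u \<phi>))"
    unfolding G_def using u by (intro distr_True_eq_density zero_density_law) auto
  have mG: "config u i \<in> measurable noise G" for i
    unfolding G_def by (rule measurable_config_noise[OF u])
  have [measurable]: "likelihood_ratio d u \<in> borel_measurable G" "f \<in> borel_measurable G"
    using f measurable_ratio by (simp_all add: G_def)
  have "(\<integral>c. f (config u True c) \<partial>noise) = integral\<^sup>L (distr noise G (config u True)) f"
    by (rule integral_distr[OF mG, symmetric]) measurable
  also have "\<dots> = (\<integral>\<phi>. likelihood_ratio d u \<phi> * f \<phi> \<partial>distr noise G (config u False))"
    unfolding D by (subst integral_density) (auto simp: ratio_nonneg)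
  also have "\<dots> = (\<integral>c. likelihood_ratio d u (config u False c) * f (config u False c) \<partial>noise)"
    by (rule integral_distr[OF mG]) measurable
  finally show ?thesis .
qed

lemma integrable_config:
  fixes f :: "_ \<Rightarrow> real"
  assumes u: "u \<in> nodes k" and f: "f \<in> borel_measurable (coords k (subtree k u d))"
    and B: "\<And>\<phi>. \<bar>f \<phi>\<bar> \<le> B"
  shows "integrable noise (\<lambda>c. f (config u i c))"
  by (rule noise.integrable_const_bound[where B = B])
    (use B measurable_compose[OF measurable_config_noise[OF u] f] in auto)

text \<open>For a single child the branching property extends to bounded functions of either sign, by
  adding a constant.\<close>

lemma integral_branching:
  fixes f :: "_ \<Rightarrow> real"
  assumes u: "u \<in> nodes k" and j: "j < k"
    and f: "f \<in> borel_measurable (coords k (subtree k (j # u) 0))" and B: "\<And>\<phi>. \<bar>f \<phi>\<bar> \<le> B"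
  shows "(\<integral>c. f (config u i c) \<partial>noise) =
    hardcore_matrix w i False * (\<integral>c. f (config (j # u) False c) \<partial>noise) +
    hardcore_matrix w i True * (\<integral>c. f (config (j # u) True c) \<partial>noise)"
proof -
  let ?p = "hardcore_matrix w"
  have ju: "j # u \<in> nodes k" using u j by simp
  define h where "h \<phi> = f \<phi> + B" for \<phi>
  have h0: "0 \<le> h \<phi>" for \<phi> using B[of \<phi>] by (simp add: h_def abs_le_iff)
  have hB: "\<bar>h \<phi>\<bar> \<le> 2 * B" for \<phi> using B[of \<phi>] by (simp add: h_def abs_le_iff)
  have hm: "h \<in> borel_measurable (coords k (subtree k (j # u) 0))"
    unfolding h_def[abs_def] using f by measurable
  have fu: "f \<in> borel_measurable (coords k (subtree k u 0))"
      and hu: "h \<in> borel_measurable (coords k (subtree k u 0))"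
  proof -
    have "subtree k (j # u) 0 \<subseteq> subtree k u (Suc 0)" using j by (auto simp: subtree_Suc)
    also have "\<dots> \<subseteq> subtree k u 0" by (rule subtree_antimono) simp
    finally have s: "subtree k (j # u) 0 \<subseteq> subtree k u 0" .
    show "f \<in> borel_measurable (coords k (subtree k u 0))" "h \<in> borel_measurable (coords k (subtree
        k u 0))"
      using measurable_coords_mono[OF s] f hm by auto
  qed
  have nn: "(\<integral>\<^sup>+c. ennreal (h (config v b c)) \<partial>noise) = ennreal (\<integral>c. h (config v b c) \<partial>noise)"
    if "v \<in> nodes k" "h \<in> borel_measurable (coords k (subtree k v 0))" for v b
    by (rule nn_integral_eq_integral[OF integrable_config[OF that hB]]) (simp add: h0)
  have h_int: "(\<integral>c. h (config v b c) \<partial>noise) = (\<integral>c. f (config v b c) \<partial>noise) + B"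
    if "v \<in> nodes k" "f \<in> borel_measurable (coords k (subtree k v 0))" for v b
    unfolding h_def by (subst Bochner_Integration.integral_add)
      (auto intro!: integrable_config[OF that B] simp: noise.prob_space)
  have pos: "0 \<le> ?p i b" for b using stochastic by (auto simp: stochastic_def)
  have psum: "?p i False + ?p i True = 1" using stochastic by (auto simp: stochastic_def)
  have I0: "0 \<le> (\<integral>c. h (config v b c) \<partial>noise)" for v b by (rule integral_nonneg_AE) (simp add: h0)
  have "ennreal (\<integral>c. h (config u i c) \<partial>noise) =
      ennreal (?p i False) * ennreal (\<integral>c. h (config (j # u) False c) \<partial>noise) +
      ennreal (?p i True) * ennreal (\<integral>c. h (config (j # u) True c) \<partial>noise)"
    using nn_integral_branching_single[OF u j, of "\<lambda>\<phi>. ennreal (h \<phi>)" i] hm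
    by (simp add: nn[OF u hu] nn[OF ju hm])
  also have "\<dots> = ennreal (?p i False * (\<integral>c. h (config (j # u) False c) \<partial>noise) +
      ?p i True * (\<integral>c. h (config (j # u) True c) \<partial>noise))"
    using pos I0 by (simp add: ennreal_mult ennreal_plus)
  finally have "(\<integral>c. h (config u i c) \<partial>noise) =
      ?p i False * (\<integral>c. h (config (j # u) False c) \<partial>noise) + ?p i True *
          (\<integral>c. h (config (j # u) True c) \<partial>noise)"
    using pos I0 by (subst (asm) ennreal_inj) auto
  then have "(\<integral>c. f (config u i c) \<partial>noise) + B =
      ?p i False * (\<integral>c. f (config (j # u) False c) \<partial>noise) + ?p i True *
          (\<integral>c. f (config (j # u) True c) \<partial>noise) +
      (?p i False + ?p i True) * B"
    unfolding h_int[OF u fu] h_int[OF ju f] by (simp only: distrib_left distrib_right add_ac)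
  then show ?thesis unfolding psum by simp
qed

section \<open>Contraction of the divergence\<close>

text \<open>The symmetrised relative entropy of the two forced laws: it is the difference of the
  expectations of the logarithm of the likelihood ratio under the laws forced to \<open>1\<close> and to
  \<open>0\<close>. For \<open>d = 0\<close> this would be infinite, and the formula gives a default value instead,
  because \<open>ln 0 = 0\<close>.\<close>

definition divergence :: "nat \<Rightarrow> nat list \<Rightarrow> real" where
  "divergence d u = (\<integral>c. (likelihood_ratio d u (config u False c) - 1) *
      ln (likelihood_ratio d u (config u False c)) \<partial>noise)"

abbreviation ratio_max :: real where
  "ratio_max \<equiv> (1 + w) ^ k"

lemma ratio_max_gt_1: "1 < ratio_max"
  using w k by (intro one_less_power) auto

lemma abs_ratio_minus_1_le: "\<bar>likelihood_ratio d u \<phi> - 1\<bar> \<le> ratio_max"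
  using ratio_nonneg[of d u \<phi>] ratio_le[of d u \<phi>] ratio_max_gt_1 by (auto simp: abs_le_iff)

lemma abs_ln_ratio_le: "\<bar>ln (likelihood_ratio (Suc d) u \<phi>)\<bar> \<le> \<bar>ln ratio_min\<bar> + \<bar>ln ratio_max\<bar>"
  by (rule abs_ln_le[OF ratio_min_pos ratio_Suc_ge ratio_le])

lemma abs_ln_Z_le: "\<bar>ln (Z (Suc d) u \<phi>)\<bar> \<le> \<bar>ln ((1 + w) / (1 + w * ratio_max))\<bar> + \<bar>ln (1 + w)\<bar>"
  using w by (intro abs_ln_le Z_Suc_ge Z_bounds divide_pos_pos add_pos_nonneg) auto

lemma measurable_ln_Z:
  assumes "j < k"
  shows "(\<lambda>\<phi>. ln (Z d (j # u) \<phi>)) \<in> borel_measurable (coords k (subtree k u (Suc d)))"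
proof -
  have "Z d (j # u) \<in> borel_measurable (coords k (subtree k u (Suc d)))"
    by (rule measurable_coords_mono[OF _ measurable_Z]) (use assms in \<open>auto simp: subtree_Suc\<close>)
  then show ?thesis by measurable
qed

text \<open>The logarithm of the likelihood ratio at \<open>u\<close> is a sum over the children of functions
  \<open>ln Z\<close> of their subtrees. Its two expectations therefore only see the law of the value of a
  single child, which is \<open>0\<close> under one of the laws and follows the weights \<open>1 / (1 + w)\<close>,
  \<open>w / (1 + w)\<close> under the other. What is left is \<open>w / (1 + w)\<close> times the difference of the
  expectations of \<open>ln Z\<close> under the two laws forced at the child, and a change of measure there
  gives the integrand of the right-hand side.\<close>

lemma divergence_Suc:
  assumes u: "u \<in> nodes k"
  shows "divergence (Suc (Suc d)) u = w / (1 + w) *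
    (\<Sum>j<k. \<integral>c. (likelihood_ratio (Suc d) (j # u) (config (j # u) False c) - 1) *
       ln ((1 + w * likelihood_ratio (Suc d) (j # u) (config (j # u) False c)) / (1 + w)) \<partial>noise)"
proof -
  let ?d = "Suc (Suc d)"
  let ?l = "\<lambda>j \<phi>. ln (Z ?d (j # u) \<phi>)"
  let ?B = "\<bar>ln ((1 + w) / (1 + w * ratio_max))\<bar> + \<bar>ln (1 + w)\<bar>"
  define L where "L \<phi> = ln (likelihood_ratio ?d u \<phi>)" for \<phi>
  have L: "L \<phi> = (\<Sum>j<k. ?l j \<phi>)" for \<phi>
    unfolding L_def likelihood_ratio_def by (rule ln_prod) (simp_all add: Z_Suc_pos less_imp_neq[OF
        Z_Suc_pos, symmetric])
  have L_meas: "L \<in> borel_measurable (coords k (subtree k u (Suc ?d)))"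
    unfolding L_def[abs_def] using measurable_ratio by measurable
  have L_bound: "\<bar>L \<phi>\<bar> \<le> \<bar>ln ratio_min\<bar> + \<bar>ln ratio_max\<bar>" for \<phi>
    unfolding L_def by (rule abs_ln_ratio_le)
  have RL_meas: "(\<lambda>\<phi>. likelihood_ratio ?d u \<phi> *
      L \<phi>) \<in> borel_measurable (coords k (subtree k u (Suc ?d)))"
    using L_meas measurable_ratio by measurable
  have RL_bound: "\<bar>likelihood_ratio ?d u \<phi> * L \<phi>\<bar> \<le> ratio_max * (\<bar>ln ratio_min\<bar> + \<bar>ln ratio_max\<bar>)" for \<phi>
    unfolding abs_mult using L_bound ratio_le[of ?d u \<phi>] ratio_nonneg[of ?d u \<phi>]
        by (intro mult_mono) auto
  have "divergence ?d u = (\<integral>c. likelihood_ratio ?d u (config u False c) * L (config u False c) -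
      L (config u False c) \<partial>noise)"
    unfolding divergence_def L_def by (simp add: left_diff_distrib)
  also have "\<dots> = (\<integral>c. likelihood_ratio ?d u (config u False c) * L (config u False c) \<partial>noise) -
      (\<integral>c. L (config u False c) \<partial>noise)"
    using integrable_config[OF u RL_meas RL_bound] integrable_config[OF u L_meas L_bound]
    by (rule Bochner_Integration.integral_diff)
  also have "\<dots> = (\<integral>c. L (config u True c) \<partial>noise) - (\<integral>c. L (config u False c) \<partial>noise)"
    unfolding integral_True[OF u L_meas] ..
  also have "\<dots> = (\<Sum>j<k. (\<integral>c. ?l j (config u True c) \<partial>noise) - (\<integral>c. ?l j (config u False c) \<partial>noise))"
    unfolding L using integrable_config[OF u measurable_ln_Z abs_ln_Z_le]
    by (subst (1 2) Bochner_Integration.integral_sum) (auto simp: sum_subtractf)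
  also have "\<dots> = (\<Sum>j<k. w / (1 + w) * (\<integral>c. (likelihood_ratio (Suc d) (j # u) (config (j # u) False
      c) - 1) *
       ln ((1 + w * likelihood_ratio (Suc d) (j # u) (config (j # u) False c)) / (1 + w)) \<partial>noise))"
  proof (rule sum.cong)
    fix j assume "j \<in> {..<k}"
    then have j: "j < k" and ju: "j # u \<in> nodes k" using u by auto
    let ?R = "likelihood_ratio (Suc d) (j # u)"
    let ?F = "\<lambda>c. config (j # u) False c" and ?T = "\<lambda>c. config (j # u) True c"
    have meas: "?l j \<in> borel_measurable (coords k (subtree k (j # u) ?d))"
      using measurable_Z by measurable
    have meas0: "?l j \<in> borel_measurable (coords k (subtree k (j # u) 0))"
      by (rule measurable_coords_mono[OF subtree_antimono meas]) simp
    have Rl_meas: "(\<lambda>\<phi>. ?R \<phi> * ?l j \<phi>) \<in> borel_measurable (coords k (subtree k (j # u) ?d))"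
      using meas measurable_ratio by measurable
    have Rl_bound: "\<bar>?R \<phi> * ?l j \<phi>\<bar> \<le> ratio_max * ?B" for \<phi>
      unfolding abs_mult using abs_ln_Z_le ratio_le[of "Suc d" "j # u" \<phi>] ratio_nonneg[of "Suc d" "j
          # u" \<phi>]
      by (intro mult_mono) auto
    have one_minus: "1 / (1 + w) = 1 - w / (1 + w)" using w by (simp add: field_simps)
    have "(\<integral>c. ?l j (config u True c) \<partial>noise) - (\<integral>c. ?l j (config u False c) \<partial>noise) =
        (\<integral>c. ?l j (?F c) \<partial>noise) - (1 / (1 + w) * (\<integral>c. ?l j (?F c) \<partial>noise) + w / (1 + w) *
            (\<integral>c. ?l j (?T c) \<partial>noise))"
      using integral_branching[OF u j meas0 abs_ln_Z_le] by (simp add: hardcore_matrix_def)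
    also have "\<dots> = w / (1 + w) * ((\<integral>c. ?l j (?F c) \<partial>noise) - (\<integral>c. ?l j (?T c) \<partial>noise))"
      unfolding one_minus by (simp add: algebra_simps)
    also have "(\<integral>c. ?l j (?T c) \<partial>noise) = (\<integral>c. ?R (?F c) * ?l j (?F c) \<partial>noise)"
      by (rule integral_True[OF ju meas])
    also have "(\<integral>c. ?l j (?F c) \<partial>noise) - (\<integral>c. ?R (?F c) * ?l j (?F c) \<partial>noise) =
        (\<integral>c. ?l j (?F c) - ?R (?F c) * ?l j (?F c) \<partial>noise)"
      by (rule Bochner_Integration.integral_diff[symmetric, OF integrable_config[OF ju meas abs_ln_Z_le]
          integrable_config[OF ju Rl_meas Rl_bound]])
    also have "\<dots> = (\<integral>c. (?R (?F c) - 1) * ln ((1 + w * ?R (?F c)) / (1 + w)) \<partial>noise)"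
    proof (rule Bochner_Integration.integral_cong)
      fix c
      have "1 + w * ?R (?F c) > 0" using w ratio_nonneg by (intro add_pos_nonneg) auto
      then show "?l j (?F c) - ?R (?F c) * ?l j (?F c) = (?R (?F c) - 1) * ln ((1 + w *
          ?R (?F c)) / (1 + w))"
        using w by (simp add: Z_Suc ln_div algebra_simps)
    qed simp
    finally show "(\<integral>c. ?l j (config u True c) \<partial>noise) - (\<integral>c. ?l j (config u False c) \<partial>noise) =
      w / (1 + w) * (\<integral>c. (?R (?F c) - 1) * ln ((1 + w * ?R (?F c)) / (1 + w)) \<partial>noise)" .
  qed simp
  finally show ?thesis by (simp add: sum_distrib_left)
qed

text \<open>The factor \<open>w / (1 + w)\<close> of the recursion, times the number of children, times the steepest
  secant slope that likelihood ratios up to \<open>(1 + w)\<^sup>k\<close> allow.\<close>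

definition contraction :: real where
  "contraction = k * w / (1 + w) * (ln ((1 + w * ratio_max) / (1 + w)) / ln ratio_max)"

lemma contraction_nonneg: "0 \<le> contraction"
  unfolding contraction_def using w ratio_max_gt_1
      by (intro mult_nonneg_nonneg divide_nonneg_nonneg ln_ge_zero) auto

lemma measurable_divergence_integrand:
  "(\<lambda>\<phi>. (likelihood_ratio d u \<phi> - 1) * ln (likelihood_ratio d u \<phi>)) \<in> borel_measurable (coords k
      (subtree k u (Suc d)))"
  using measurable_ratio by measurable

lemma divergence_integrand_bound:
  "\<bar>(likelihood_ratio (Suc d) u \<phi> - 1) * ln (likelihood_ratio (Suc d) u \<phi>)\<bar> \<le> ratio_max *
      (\<bar>ln ratio_min\<bar> + \<bar>ln ratio_max\<bar>)"
  unfolding abs_mult using w by (intro mult_mono abs_ratio_minus_1_le abs_ln_ratio_le) auto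

lemma divergence_contraction:
  assumes u: "u \<in> nodes k" and B: "\<And>v. v \<in> nodes k \<Longrightarrow> divergence (Suc d) v \<le> B"
  shows "divergence (Suc (Suc d)) u \<le> contraction * B"
proof -
  let ?s = "ln ((1 + w * ratio_max) / (1 + w)) / ln ratio_max"
  have s: "0 \<le> ?s" using w ratio_max_gt_1 by (intro divide_nonneg_nonneg ln_ge_zero) auto
  have "(\<integral>c. (likelihood_ratio (Suc d) (j # u) (config (j # u) False c) - 1) *
       ln ((1 + w * likelihood_ratio (Suc d) (j # u) (config (j # u) False c)) / (1 + w)) \<partial>noise) \<le>
           ?s * B" (is "?I j \<le> _") if "j < k" for j
  proof -
    let ?R = "\<lambda>c. likelihood_ratio (Suc d) (j # u) (config (j # u) False c)"
    have ju: "j # u \<in> nodes k" using that u by simp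
    have "?I j \<le> (\<integral>c. ?s * ((?R c - 1) * ln (?R c)) \<partial>noise)"
    proof (rule integral_mono')
      show "integrable noise (\<lambda>c. ?s * ((?R c - 1) * ln (?R c)))"
        by (intro integrable_mult_right integrable_config[OF ju measurable_divergence_integrand
            divergence_integrand_bound])
      fix c
      show "(?R c - 1) * ln ((1 + w * ?R c) / (1 + w)) \<le> ?s * ((?R c - 1) * ln (?R c))"
        by (rule secant_bound[OF w ratio_max_gt_1 ratio_Suc_pos ratio_le])
      have "0 \<le> (?R c - 1) * ln (?R c)"
      proof -
        have "(?R c - 1)\<^sup>2 \<le> ratio_max * ((?R c - 1) * ln (?R c))"
          using ratio_max_gt_1 by (intro square_le_mult_ln ratio_Suc_pos ratio_le) simp
        then have "0 \<le> ratio_max * ((?R c - 1) * ln (?R c))" by (rule order_trans[OF zero_le_power2])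
        then show ?thesis using ratio_max_gt_1 by (simp add: zero_le_mult_iff)
      qed
      then show "0 \<le> ?s * ((?R c - 1) * ln (?R c))" using s by (rule mult_nonneg_nonneg[rotated])
    qed
    also have "\<dots> = ?s * divergence (Suc d) (j # u)"
      unfolding divergence_def by simp
    also have "\<dots> \<le> ?s * B" using B[OF ju] s by (intro mult_left_mono)
    finally show ?thesis .
  qed
  then have "(\<Sum>j<k. ?I j) \<le> (\<Sum>j<k. ?s * B)" by (intro sum_mono) auto
  then have "divergence (Suc (Suc d)) u \<le> w / (1 + w) * (\<Sum>j<k. ?s * B)"
    unfolding divergence_Suc[OF u] using w by (intro mult_left_mono) auto
  also have "\<dots> = contraction * B" by (simp add: contraction_def mult_ac)
  finally show ?thesis .
qed

lemma divergence_le: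
  assumes "u \<in> nodes k"
  shows "divergence (Suc d) u \<le> contraction ^ d * (ratio_max * (\<bar>ln ratio_min\<bar> + \<bar>ln ratio_max\<bar>))"
  using assms
proof (induction d arbitrary: u)
  case 0
  have "divergence (Suc 0) u \<le> (\<integral>c. ratio_max * (\<bar>ln ratio_min\<bar> + \<bar>ln ratio_max\<bar>) \<partial>noise)"
    unfolding divergence_def
    by (intro integral_mono integrable_config[OF 0 measurable_divergence_integrand
        divergence_integrand_bound]
        order_trans[OF abs_ge_self divergence_integrand_bound]) simp
  then show ?case by (simp add: noise.prob_space)
next
  case (Suc d)
  then show ?case using divergence_contraction[OF Suc.prems Suc.IH] by (simp add: mult.assoc)
qed

section \<open>Triviality of the tail\<close>

text \<open>The difference of the two probabilities is the expectation of \<open>R - 1\<close> on the event, for the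
  likelihood ratio \<open>R\<close>; its square is at most the second moment, which the divergence
  controls.\<close>

lemma prob_config_diff_le:
  assumes u: "u \<in> nodes k" and S: "S \<in> sets (coords k (subtree k u (Suc (Suc d))))"
  shows "(noise.prob {c \<in> space noise. config u True c \<in> S} -
      noise.prob {c \<in> space noise. config u False c \<in> S})\<^sup>2
    \<le> ratio_max * divergence (Suc d) u"
proof -
  let ?R = "\<lambda>c. likelihood_ratio (Suc d) u (config u False c)"
  let ?i = "indicat_real S"
  have iS: "?i \<in> borel_measurable (coords k (subtree k u (Suc (Suc d))))" using S by simp
  have p: "noise.prob {c \<in> space noise. config u b c \<in> S} = (\<integral>c. ?i (config u b c) \<partial>noise)" for b
  proof -
    have "{c \<in> space noise. config u b c \<in> S} \<in> sets noise"
      using measurable_sets[OF measurable_config_noise[OF u] S, of b]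
          by (simp add: vimage_def Int_def conj_commute)
    then have "noise.prob {c \<in> space noise. config u b c \<in> S} =
        (\<integral>c. indicat_real {c \<in> space noise. config u b c \<in> S} c \<partial>noise)"
      by simp
    also have "\<dots> = (\<integral>c. ?i (config u b c) \<partial>noise)"
      by (rule Bochner_Integration.integral_cong) (auto simp: indicator_def)
    finally show ?thesis .
  qed
  define f where "f \<phi> = (likelihood_ratio (Suc d) u \<phi> - 1) * ?i \<phi>" for \<phi>
  have f_meas: "f \<in> borel_measurable (coords k (subtree k u (Suc (Suc d))))"
    unfolding f_def[abs_def] using iS measurable_ratio by measurable
  have f_bound: "\<bar>f \<phi>\<bar> \<le> ratio_max" for \<phi>
    unfolding f_def using abs_ratio_minus_1_le[of "Suc d" u \<phi>] ratio_max_gt_1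
        by (auto simp: indicator_def)
  have f2_meas: "(\<lambda>\<phi>. (f \<phi>)\<^sup>2) \<in> borel_measurable (coords k (subtree k u (Suc (Suc d))))"
    using f_meas by measurable
  have f2_bound: "\<bar>(f \<phi>)\<^sup>2\<bar> \<le> ratio_max\<^sup>2" for \<phi>
    using f_bound[of \<phi>] power_mono[OF f_bound[of \<phi>], of 2] by simp
  have int_f: "integrable noise (\<lambda>c. f (config u False c))"
    by (rule integrable_config[OF u f_meas f_bound])
  have int_f2: "integrable noise (\<lambda>c. (f (config u False c))\<^sup>2)"
    by (rule integrable_config[OF u f2_meas f2_bound])
  have Ri_meas: "(\<lambda>\<phi>. likelihood_ratio (Suc d) u \<phi> *
      ?i \<phi>) \<in> borel_measurable (coords k (subtree k u (Suc (Suc d))))"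
    using iS measurable_ratio by measurable
  have Ri_bound: "\<bar>likelihood_ratio (Suc d) u \<phi> * ?i \<phi>\<bar> \<le> ratio_max" for \<phi>
    using ratio_nonneg[of "Suc d" u \<phi>] ratio_le[of "Suc d" u \<phi>] by (auto simp: indicator_def)
  have i_bound: "\<bar>?i \<phi>\<bar> \<le> 1" for \<phi> by (auto simp: indicator_def)
  have "noise.prob {c \<in> space noise. config u True c \<in> S} -
      noise.prob {c \<in> space noise. config u False c \<in> S} =
      (\<integral>c. ?R c * ?i (config u False c) \<partial>noise) - (\<integral>c. ?i (config u False c) \<partial>noise)"
    unfolding p integral_True[OF u iS] ..
  also have "\<dots> = (\<integral>c. ?R c * ?i (config u False c) - ?i (config u False c) \<partial>noise)"
    by (rule Bochner_Integration.integral_diff[symmetric, OF integrable_config[OF u Ri_meas Ri_bound]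
        integrable_config[OF u iS i_bound]])
  also have "\<dots> = (\<integral>c. f (config u False c) \<partial>noise)"
    unfolding f_def by (simp add: left_diff_distrib)
  finally have eq: "noise.prob {c \<in> space noise. config u True c \<in> S} -
      noise.prob {c \<in> space noise. config u False c \<in> S} =
    (\<integral>c. f (config u False c) \<partial>noise)" .
  have "(\<integral>c. f (config u False c) \<partial>noise)\<^sup>2 \<le> (\<integral>c. (f (config u False c))\<^sup>2 \<partial>noise)"
    using noise.variance_positive[of "\<lambda>c. f (config u False c)"] noise.variance_eq[OF int_f int_f2]
        by simp
  also have "\<dots> \<le> (\<integral>c. ratio_max * ((?R c - 1) * ln (?R c)) \<partial>noise)"
  proof (rule integral_mono[OF int_f2])
    show "integrable noise (\<lambda>c. ratio_max * ((?R c - 1) * ln (?R c)))"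
      by (intro integrable_mult_right integrable_config[OF u measurable_divergence_integrand
          divergence_integrand_bound])
    fix c
    have "(f (config u False c))\<^sup>2 \<le> (?R c - 1)\<^sup>2" by (auto simp: f_def indicator_def)
    also have "\<dots> \<le> ratio_max * ((?R c - 1) * ln (?R c))"
      using ratio_max_gt_1 by (intro square_le_mult_ln ratio_Suc_pos ratio_le) simp
    finally show "(f (config u False c))\<^sup>2 \<le> ratio_max * ((?R c - 1) * ln (?R c))" .
  qed
  also have "\<dots> = ratio_max * divergence (Suc d) u" unfolding divergence_def by simp
  finally show ?thesis unfolding eq .
qed

lemma tail_law_eq:
  assumes u: "u \<in> nodes k" and S: "\<And>d. S \<in> sets (coords k (subtree k u (Suc (Suc d))))"
    and contr: "contraction < 1"
  shows "noise.prob {c \<in> space noise. config u True c \<in> S} =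
      noise.prob {c \<in> space noise. config u False c \<in> S}"
proof -
  let ?x = "noise.prob {c \<in> space noise. config u True c \<in> S} -
      noise.prob {c \<in> space noise. config u False c \<in> S}"
  let ?B = "ratio_max * (\<bar>ln ratio_min\<bar> + \<bar>ln ratio_max\<bar>)"
  have "?x\<^sup>2 \<le> ratio_max * (contraction ^ d * ?B)" for d
  proof -
    have "?x\<^sup>2 \<le> ratio_max * divergence (Suc d) u" by (rule prob_config_diff_le[OF u S])
    also have "\<dots> \<le> ratio_max * (contraction ^ d * ?B)"
      using ratio_max_gt_1 by (intro mult_left_mono divergence_le[OF u]) auto
    finally show ?thesis .
  qed
  moreover have "(\<lambda>d. ratio_max * (contraction ^ d * ?B)) \<longlonglongrightarrow> ratio_max * (0 * ?B)"
    using contraction_nonneg contr by (intro tendsto_intros LIMSEQ_realpow_zero)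
  ultimately have "?x\<^sup>2 \<le> ratio_max * (0 * ?B)"
    by (intro LIMSEQ_le_const) auto
  then show ?thesis by simp
qed

text \<open>The two forced laws agree on the tail, so every tail event is independent of the value at
  \<open>u\<close>. The conditional probability is then the constant \<open>q False\<close>, the probability that \<open>u\<close> has
  value \<open>0\<close>.\<close>

lemma reconstruction_impossible_if_contraction:
  assumes contr: "contraction < 1"
  shows "reconstruction_impossible k (hardcore_matrix w)"
  unfolding reconstruction_impossible_def
proof
  fix u assume u: "u \<in> nodes k"
  let ?\<mu> = "brw k (hardcore_matrix w)" and ?T = "tail_algebra k u"
  interpret \<mu>: prob_space ?\<mu> by (rule prob_space_brw)
  interpret finite_measure_subalgebra ?\<mu> ?T
    by (rule finite_measure_subalgebra.intro)
      (use \<mu>.finite_measure_axioms subalgebra_tail_algebra[OF u] in \<open>auto simp: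
          finite_measure_subalgebra_axioms_def\<close>)
  define q where "q i = measure ?\<mu> {\<phi> \<in> space (config_space k). \<phi> u = i}" for i
  have space: "space ?\<mu> = space (config_space k)" and sets: "sets ?\<mu> = sets (config_space k)"
    by (simp_all add: brw_def)
  have sub: "sets (coords k (subtree k u 0)) \<subseteq> sets ?\<mu>"
    unfolding sets sets_coords by (rule coord_algebra_subset[OF subtree_subset_nodes[OF u]])
  have val: "{\<phi> \<in> space (config_space k). \<phi> u = i} \<in> sets ?\<mu>" for i
    using subsetD[OF sub measurable_sets[OF measurable_coord[OF self_in_subtree[of u k]], of "{i}"]]
    by (auto simp: vimage_def Int_def conj_commute)
  have "q False + q True = measure ?\<mu> ({\<phi> \<in> space (config_space k). \<phi> u = False} \<union>
      {\<phi> \<in> space (config_space k). \<phi> u = True})"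
    unfolding q_def by (intro \<mu>.finite_measure_Union[symmetric] val) auto
  also have "{\<phi> \<in> space (config_space k). \<phi> u = False} \<union> {\<phi> \<in> space (config_space k). \<phi> u = True} =
      space ?\<mu>"
    by (auto simp: space)
  finally have q: "q False + q True = 1" by (simp add: \<mu>.prob_space)
  let ?X = "{\<phi> \<in> space ?\<mu>. \<phi> u = False}"
  have X: "?X \<in> sets ?\<mu>" using val[of False] by (simp add: space)
  have "AE \<phi> in ?\<mu>. real_cond_exp ?\<mu> ?T (indicator ?X) \<phi> = q False"
  proof (rule real_cond_exp_charact)
    fix S assume "S \<in> sets ?T"
    then have tail: "S \<in> sets (coords k (subtree k u d))" if "d \<ge> 1" for d
      using that by (auto simp: sets_tail_algebra sets_coords subtree_def)
    have S0: "S \<in> sets (coords k (subtree k u 0))"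
    proof -
      have "sets (coords k (subtree k u 1)) \<subseteq> sets (coords k (subtree k u 0))"
        unfolding sets_coords coord_algebra_def using subtree_antimono[of 0 1 k u]
        by (intro sigma_sets_subseteq Collect_mono impI) (elim exE conjE, intro exI conjI,
            assumption, blast)
      then show ?thesis using tail[of 1] by auto
    qed
    have S\<mu>: "S \<in> sets ?\<mu>" using S0 sub by auto
    have split: "measure ?\<mu> {\<phi> \<in> S. \<phi> u = i} = q i *
        noise.prob {c \<in> space noise. config u False c \<in> S}" for i
    proof -
      have "noise.prob {c \<in> space noise. config u i c \<in> S} =
          noise.prob {c \<in> space noise. config u False c \<in> S}"
        using tail_law_eq[OF u tail contr] by (cases i) auto
      moreover have "ennreal (measure ?\<mu> {\<phi> \<in> S. \<phi> u = i}) = ennreal (q i *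
          noise.prob {c \<in> space noise. config u i c \<in> S})"
        using emeasure_brw_subtree[OF u S0, of i]
        by (simp add: \<mu>.emeasure_eq_measure noise.emeasure_eq_measure q_def ennreal_mult)
      ultimately show ?thesis by (subst (asm) ennreal_inj) (auto simp: q_def)
    qed
    have Si: "{\<phi> \<in> S. \<phi> u = i} \<in> sets ?\<mu>" for i
    proof -
      have "{\<phi> \<in> S. \<phi> u = i} = S \<inter> {\<phi> \<in> space (config_space k). \<phi> u = i}"
        using sets.sets_into_space[OF S\<mu>] by (auto simp: space)
      then show ?thesis using S\<mu> val by auto
    qed
    have "measure ?\<mu> S = measure ?\<mu> ({\<phi> \<in> S. \<phi> u = False} \<union> {\<phi> \<in> S. \<phi> u = True})"
      by (rule arg_cong[where f = "measure ?\<mu>"]) auto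
    also have "\<dots> = measure ?\<mu> {\<phi> \<in> S. \<phi> u = False} + measure ?\<mu> {\<phi> \<in> S. \<phi> u = True}"
      by (intro \<mu>.finite_measure_Union Si) auto
    also have "\<dots> = noise.prob {c \<in> space noise. config u False c \<in> S}"
      unfolding split distrib_right[symmetric] q by simp
    finally have mS: "measure ?\<mu> S = noise.prob {c \<in> space noise. config u False c \<in> S}" .
    have "(\<integral>\<phi>\<in>S. indicator ?X \<phi> \<partial>?\<mu>) = (\<integral>\<phi>. indicat_real {\<phi> \<in> S. \<phi> u = False} \<phi> \<partial>?\<mu>)"
      unfolding set_lebesgue_integral_def
      by (rule Bochner_Integration.integral_cong) (auto simp: indicator_def)
    also have "\<dots> = measure ?\<mu> {\<phi> \<in> S. \<phi> u = False}" using Si[of False] by simp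
    also have "\<dots> = q False * measure ?\<mu> S" unfolding split mS ..
    also have "\<dots> = (\<integral>\<phi>\<in>S. q False \<partial>?\<mu>)"
      unfolding set_lebesgue_integral_def using S\<mu> by simp
    finally show "(\<integral>\<phi>\<in>S. indicator ?X \<phi> \<partial>?\<mu>) = (\<integral>\<phi>\<in>S. q False \<partial>?\<mu>)" .
  next
    show "integrable ?\<mu> (indicat_real ?X)" using X by (simp add: \<mu>.emeasure_eq_measure)
  qed auto
  then show "\<exists>c. AE \<phi> in ?\<mu>. posterior0 k (hardcore_matrix w) u \<phi> = c"
    unfolding posterior0_def by blast
qed

lemma contraction_less_1:
  assumes "w * ln (1 + w * (1 + w) ^ k) < (1 + 2 * w) * ln (1 + w)"
  shows "contraction < 1"
proof -
  have l: "ln (1 + w) > 0" using w by simp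
  have "1 + w * ratio_max > 0" using w by (intro add_pos_nonneg) auto
  then have "contraction = w * (ln (1 + w * ratio_max) - ln (1 + w)) / ((1 + w) * ln (1 + w))"
    using w k l by (simp add: contraction_def ln_div ln_realpow)
  also have "\<dots> < 1"
  proof (subst divide_less_eq_1_pos)
    show "0 < (1 + w) * ln (1 + w)" using w l by (intro mult_pos_pos) auto
    show "w * (ln (1 + w * ratio_max) - ln (1 + w)) < (1 + w) * ln (1 + w)"
      using assms by (simp add: algebra_simps)
  qed
  finally show ?thesis .
qed

end

section \<open>The critical fugacity\<close>

lemma fugacity_root:
  assumes "lam > 0"
  shows "fugacity_root k lam > 0" "fugacity_root k lam * (1 + fugacity_root k lam) ^ k = lam"
  using theI'[OF fugacity_root_ex1[OF assms, of k]] by (auto simp: fugacity_root_def)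

lemma fugacity_root_mono:
  assumes "0 < lam" "lam \<le> lam'"
  shows "fugacity_root k lam \<le> fugacity_root k lam'"
proof (rule ccontr)
  let ?w = "fugacity_root k lam" and ?w' = "fugacity_root k lam'"
  have pos: "lam' > 0" using assms by simp
  assume "\<not> ?w \<le> ?w'"
  then have "?w' * (1 + ?w') ^ k \<le> ?w' * (1 + ?w) ^ k" "?w' * (1 + ?w) ^ k < ?w * (1 + ?w) ^ k"
    using fugacity_root(1)[OF assms(1), of k] fugacity_root(1)[OF pos, of k]
    by (auto intro!: mult_left_mono power_mono)
  then show False using fugacity_root(2)[OF assms(1), of k] fugacity_root(2)[OF pos, of k] assms
      by linarith
qed

text \<open>A bound on \<open>\<lambda>\<close> that implies the condition of \<open>contraction_less_1\<close> and is easier to compare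
  across different \<open>\<lambda>\<close>, obtained from \<open>ln (1 + w) \<ge> w / (1 + w)\<close>.\<close>

lemma reconstruction_impossible_if_ln_less:
  assumes "k \<ge> 1" "lam > 0"
    and "ln (1 + lam) < 1 + fugacity_root k lam / (1 + fugacity_root k lam)"
  shows "reconstruction_impossible k (hardcore_matrix (fugacity_root k lam))"
proof -
  define w where "w = fugacity_root k lam"
  have w: "w > 0" and lam: "w * (1 + w) ^ k = lam"
    using fugacity_root[OF assms(2), of k] by (simp_all add: w_def)
  interpret hardcore k w using assms(1) w by unfold_locales
  have "ln (1 / (1 + w)) \<le> 1 / (1 + w) - 1" using w by (intro ln_le_minus_one) auto
  then have ln_w: "w / (1 + w) \<le> ln (1 + w)" using w by (simp add: ln_div field_simps)
  have "w * ln (1 + lam) < w * (1 + w / (1 + w))"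
    using w assms(3) by (intro mult_strict_left_mono) (simp_all add: w_def)
  also have "\<dots> = (1 + 2 * w) * (w / (1 + w))" using w by (simp add: field_simps)
  also have "\<dots> \<le> (1 + 2 * w) * ln (1 + w)" using ln_w w by (intro mult_left_mono) auto
  finally have "contraction < 1" by (intro contraction_less_1) (simp add: lam)
  then show ?thesis unfolding w_def[symmetric] by (rule reconstruction_impossible_if_contraction)
qed

theorem theorem2:
  fixes k :: nat
  assumes "k \<ge> 1"
  shows "lambda_c k > ereal (exp 1 - 1)"
proof -
  have e: "exp 1 - 1 > (0 :: real)" by simp
  define w0 where "w0 = fugacity_root k (exp 1 - 1)"
  have w0: "w0 > 0" unfolding w0_def by (rule fugacity_root(1)[OF e])
  \<comment> \<open>as \<open>w\<close> increases with \<open>\<lambda>\<close>, the criterion \<open>ln (1 + \<lambda>) < 1 + w / (1 + w)\<close> holds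
      up to this value\<close>
  define lam0 where "lam0 = exp (1 + w0 / (1 + w0)) - 1"
  have "ereal lam0 \<le> lambda_c k"
    unfolding lambda_c_def
  proof (rule Inf_greatest, clarify)
    fix lam :: real
    assume lam: "lam > 0" and poss: "reconstruction_possible k (hardcore_matrix (fugacity_root k lam))"
    show "ereal lam0 \<le> ereal lam"
    proof (rule ccontr)
      assume "\<not> ereal lam0 \<le> ereal lam"
      then have "1 + lam < exp (1 + w0 / (1 + w0))" by (simp add: lam0_def)
      then have lt: "ln (1 + lam) < 1 + w0 / (1 + w0)"
        using lam by (metis add_pos_pos exp_less_cancel_iff exp_ln zero_less_one)
      let ?w = "fugacity_root k lam"
      have "?w > 0" by (rule fugacity_root(1)[OF lam])
      have "ln (1 + lam) < 1 + ?w / (1 + ?w)"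
      proof (cases "lam \<le> exp 1 - 1")
        case True
        then have "1 + lam \<le> exp 1" by simp
        then have "ln (1 + lam) \<le> 1" using lam
            by (metis add_pos_pos exp_le_cancel_iff exp_ln zero_less_one)
        also have "1 < 1 + ?w / (1 + ?w)" using \<open>?w > 0\<close> by simp
        finally show ?thesis .
      next
        case False
        then have "w0 \<le> ?w" unfolding w0_def by (intro fugacity_root_mono[OF e]) simp
        then have "w0 / (1 + w0) \<le> ?w / (1 + ?w)" using w0 by (simp add: field_simps)
        then show ?thesis using lt by simp
      qed
      then have "reconstruction_impossible k (hardcore_matrix ?w)"
        by (rule reconstruction_impossible_if_ln_less[OF assms lam])
      then show False using poss by (simp add: reconstruction_possible_def)
    qed
  qed
  moreover have "exp 1 - 1 < lam0" unfolding lam0_def using w0 by simp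
  ultimately show ?thesis by (metis less_ereal.simps(1) less_le_trans)
qed

end
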